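(* There are a time $T>0$ and positive constants $A,c_1,c_2,C$ and $\rho$, independent of $N$, such that for every $N\ge2$ and every $\xi\in\mathbb{N}^N$, $$E\big(\exp(\rho R(\xi^\xi_T))\big)-\exp(\rho R(\xi))<-c_1e^{\rho R(\xi)}\mathbf{1}_{\{R(\xi)>A\}}+Nc_2e^{-CR(\xi)} .$$ As a consequence, for each $N\ge2$ there is a unique invariant probability measure $\lambda^N$ for the $N$-particle Fleming-Viot process. Furthermore, there is a constant $\kappa>0$ such that for every $N\ge2$, $$\int\exp(\rho R(\xi))\,d\lambda^N(\xi)\le\kappa N .$$
   Context: $\mathbb{N}=\{1,2,\dots\}$. Galton-Watson rates: $p$ is a probability distribution on $\mathbb{N}\cup\{0\}$ such that $\sum_{\ell\ge0}p(\ell)e^{\sigma\ell}<\infty$ for some $\sigma>0$ and $\sum_{\ell\ge-1}\ell\,p(\ell+1)<0$ (subcriticality). The continuous-time Galton-Watson process on $\mathbb{N}\cup\{0\}$ with offspring law $p$ has jump rates, for $x\ne y$, $q(x,y)=x\,p(0)$ if $y=x-1\ge0$, $q(x,y)=x\,p(y-x+1)$ if $y>x\ge1$, and $q(x,y)=0$ otherwise. Fleming-Viot process with $N$ particles ($N\ge2$): the Markov process on $\mathbb{N}^N$ in which each particle moves independently as the Galton-Watson process, except that when a particle hits $0$ it instantaneously jumps to the position of one of the other $N-1$ particles chosen uniformly at random. With $m(x,\xi)=\frac1N\sum_{i=1}^N\mathbf{1}_{\{\xi(i)=x\}}$, its generator on bounded $f:\mathbb{N}^N\to\mathbb{R}$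 is $$\mathcal{L}^Nf(\xi)=\sum_{i=1}^N\sum_{y=1}^\infty\Big[q(\xi(i),y)+q(\xi(i),0)\tfrac{N}{N-1}m(y,\xi)\Big]\,[f(\xi^{i,y})-f(\xi)],$$ where $\xi^{i,y}(i)=y$ and $\xi^{i,y}(j)=\xi(j)$ for $j\ne i$. $\xi^\xi_t$ denotes this process at time $t$ started from the configuration $\xi$. $R(\xi):=\max_{1\le i\le N}\xi(i)$ is the position of the rightmost particle. *)

theory Defs
  imports "HOL-Probability.Probability"
begin

definition gw_offspring_law :: "nat pmf \<Rightarrow> bool" where
  "gw_offspring_law p \<longleftrightarrow>
     (\<exists>\<sigma>>0. summable (\<lambda>l. pmf p l * exp (\<sigma> * real l))) \<and>
     (\<Sum>k. (real k - 1) * pmf p k) < 0"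
  (* The second sum is the sum over l >= -1 of l p(l+1), indexed by k = l + 1;
     it converges absolutely by the exponential moment condition. *)

definition gw_rate :: "nat pmf \<Rightarrow> nat \<Rightarrow> nat \<Rightarrow> real" where
  "gw_rate p x y =
     (if x = y + 1 then real x * pmf p 0
      else if 1 \<le> x \<and> x < y then real x * pmf p (y - x + 1)
      else 0)"

(* Particles are labelled by {1..N}; configurations are functions on {1..N}, extended by
   the value undefined elsewhere, so that equality of configurations is equality in the
   N-fold power of the positive integers. *)
definition configs :: "nat \<Rightarrow> (nat \<Rightarrow> nat) set" where
  "configs N = {1..N} \<rightarrow>\<^sub>E {1..}"

definition empirical :: "nat \<Rightarrow> nat \<Rightarrow> (nat \<Rightarrow> nat) \<Rightarrow> real" where
  "empirical N x \<xi> = 1 / real N * (\<Sum>i=1..N. of_bool (\<xi> i = x))"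

definition fv_generator ::
    "nat pmf \<Rightarrow> nat \<Rightarrow> ((nat \<Rightarrow> nat) \<Rightarrow> real) \<Rightarrow> (nat \<Rightarrow> nat) \<Rightarrow> real" where
  "fv_generator p N f \<xi> =
     (\<Sum>i=1..N. \<Sum>\<^sub>\<infinity>y\<in>{1..}.
        (gw_rate p (\<xi> i) y
          + gw_rate p (\<xi> i) 0 * (real N / (real N - 1)) * empirical N y \<xi>)
        * (f (\<xi>(i := y)) - f \<xi>))"

(* P t x is the law at time t of the process started from x. Laws on the countable state
   space S are probability mass functions, so the process is conservative (no explosion). *)
definition markov_semigroup :: "'a set \<Rightarrow> (real \<Rightarrow> 'a \<Rightarrow> 'a pmf) \<Rightarrow> bool" where
  "markov_semigroup S P \<longleftrightarrow>
     (\<forall>t\<ge>0. \<forall>x\<in>S. set_pmf (P t x) \<subseteq> S) \<and>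
     (\<forall>x\<in>S. P 0 x = return_pmf x) \<and>
     (\<forall>s\<ge>0. \<forall>t\<ge>0. \<forall>x\<in>S. P (s + t) x = bind_pmf (P s x) (P t))"

(* The convergence is pointwise in the starting point: for unbounded jump rates, L f is in
   general unbounded for bounded f. *)
definition has_generator ::
    "'a set \<Rightarrow> (real \<Rightarrow> 'a \<Rightarrow> 'a pmf) \<Rightarrow> (('a \<Rightarrow> real) \<Rightarrow> 'a \<Rightarrow> real) \<Rightarrow> bool" where
  "has_generator S P L \<longleftrightarrow>
     (\<forall>f. bounded (f ` S) \<longrightarrow>
       (\<forall>x\<in>S. ((\<lambda>h. (measure_pmf.expectation (P h x) f - f x) / h) \<longlongrightarrow> L f x)
          (at_right 0)))"

definition fleming_viot ::
    "nat pmf \<Rightarrow> nat \<Rightarrow> (real \<Rightarrow> (nat \<Rightarrow> nat) \<Rightarrow> (nat \<Rightarrow> nat) pmf) \<Rightarrow> bool" where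
  "fleming_viot p N P \<longleftrightarrow>
     markov_semigroup (configs N) P \<and> has_generator (configs N) P (fv_generator p N)"

definition invariant_law :: "'a set \<Rightarrow> (real \<Rightarrow> 'a \<Rightarrow> 'a pmf) \<Rightarrow> 'a pmf \<Rightarrow> bool" where
  "invariant_law S P \<mu> \<longleftrightarrow> set_pmf \<mu> \<subseteq> S \<and> (\<forall>t\<ge>0. bind_pmf \<mu> (P t) = \<mu>)"

definition rightmost :: "nat \<Rightarrow> (nat \<Rightarrow> nat) \<Rightarrow> real" where
  "rightmost N \<xi> = real (Max (\<xi> ` {1..N}))"

end

theory Submission
  imports Defs "HOL-Complex_Analysis.Great_Picard"
begin

text \<open>
  The drift inequality rests on a large deviation estimate that is uniform in the number of particles.
  For a subcritical Galton-Watson process the function \<open>x \<mapsto> exp (\<theta> * x)\<close> has, for small \<open>\<theta> \<ge> 0\<close>, a drift of at most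
  \<open>- v * \<theta> * x * exp (\<theta> * x)\<close> (\<open>gw_subcritical_exponent\<close>), so \<open>exp (\<phi> t * x)\<close> with \<open>\<phi>\<close> decaying at rate \<open>v\<close> is a
  supersolution of the backward equation. In the Fleming-Viot system the sum of these exponentials over all
  particles changes in addition by relocations: each particle is relocated at rate at most \<open>1\<close>, to a uniformly
  chosen other particle, so relocations enlarge the sum at relative rate at most \<open>N / (N - 1) \<le> 2\<close>
  (\<open>fv_generator_exponential\<close>). Hence the sum of \<open>exp (3 * \<rho> * \<eta> i)\<close> at time \<open>T\<close>, where \<open>exp (- v * T) = 1 / 4\<close>, has
  mean at most \<open>exp (2 * T) * N * exp (3 / 4 * \<rho> * R)\<close> if the initial maximum is \<open>R\<close> (\<open>fv_exponential_moment\<close>).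
  At time \<open>T\<close> the maximum is either at most \<open>R / 2\<close>, in which case \<open>exp (\<rho> * R)\<close> has shrunk at least by the factor
  \<open>exp (- \<rho> * R / 2)\<close>, or the excess over \<open>R / 2\<close> pays for a term of order \<open>N * exp (- \<rho> * R / 4)\<close>
  (\<open>fv_rightmost_drift\<close>).

  The process is given only through the derivative at time \<open>0\<close> of its semigroup on bounded functions, while
  the exponentials are unbounded. The passage is a parabolic comparison principle (\<open>semigroup_comparison\<close>):
  bounded data give a solution of the backward equation that is continuous in time, and a coercive
  supersolution above it initially stays above it, since a first violation would
  occur on a finite set of states and contradict the maximum principle. Truncations of the exponential sum
  are bounded data, and monotone convergence removes the truncation.

  For the invariant law, consider the kernel \<open>P T\<close>. The drift inequality is a Foster-Lyapunov condition for a
  function with finite sublevel sets, so limits of Cesaro averages exist, are stationary, and satisfy the moment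
  bound, which is linear in \<open>N\<close> because the additive constant of the drift is (\<open>stationary_pmf_exists\<close>). Every
  configuration reaches the one with all particles at \<open>1\<close> with positive probability in any positive time
  (\<open>fv_reaches_all_ones\<close>), so \<open>P T\<close> has only one stationary law (\<open>stationary_pmf_unique\<close>).
  Since the kernels of the semigroup commute, this law is invariant at all times.
\<close>

section \<open>Expectations under probability mass functions\<close>

lemma integrable_pmf_bounded:
  fixes f :: "'a \<Rightarrow> real"
  assumes "\<And>x. x \<in> set_pmf M \<Longrightarrow> \<bar>f x\<bar> \<le> B"
  shows "integrable (measure_pmf M) f"
  using assms
  by (intro measure_pmf.integrable_const_bound[where B = B]) (auto simp: AE_measure_pmf_iff)

lemma abs_expectation_pmf_le:
  fixes f :: "'a \<Rightarrow> real"
  assumes "\<And>x. x \<in> set_pmf M \<Longrightarrow> \<bar>f x\<bar> \<le> B"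
  shows "\<bar>measure_pmf.expectation M f\<bar> \<le> B"
proof -
  have int: "integrable (measure_pmf M) f"
    using assms by (rule integrable_pmf_bounded)
  have "measure_pmf.expectation M f \<le> B"
    by (rule measure_pmf.integral_le_const[OF int])
       (use assms in \<open>fastforce simp: AE_measure_pmf_iff\<close>)
  moreover have "- B \<le> measure_pmf.expectation M f"
    by (rule measure_pmf.integral_ge_const[OF int])
       (use assms in \<open>fastforce simp: AE_measure_pmf_iff\<close>)
  ultimately show ?thesis
    by linarith
qed

lemma expectation_bind_pmf:
  fixes f :: "'b \<Rightarrow> real"
  assumes B: "\<And>y. y \<in> set_pmf (bind_pmf M K) \<Longrightarrow> \<bar>f y\<bar> \<le> B"
  shows "measure_pmf.expectation (bind_pmf M K) f
       = measure_pmf.expectation M (\<lambda>x. measure_pmf.expectation (K x) f)"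
proof -
  \<comment> \<open>The bound holds on the support only, while the kernel integral asks for it everywhere.\<close>
  define g where "g y = (if y \<in> set_pmf (bind_pmf M K) then f y else 0)" for y
  obtain z where "z \<in> set_pmf (bind_pmf M K)"
    using set_pmf_not_empty[of "bind_pmf M K"] by blast
  then have "B \<ge> 0"
    using B[of z] by linarith
  then have g: "\<bar>g y\<bar> \<le> B" for y
    using B by (simp add: g_def)
  have "measure_pmf.expectation (bind_pmf M K) f = measure_pmf.expectation (bind_pmf M K) g"
    by (intro integral_cong_AE) (auto simp: AE_measure_pmf_iff g_def)
  also have "\<dots> = measure_pmf.expectation M (\<lambda>x. measure_pmf.expectation (K x) g)"
    unfolding measure_pmf_bind
    using g by (intro integral_bind[where K = "count_space UNIV" and B' = 1 and B = B])
      (auto simp: measure_pmf.emeasure_space_1 measure_pmf_in_subprob_algebra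
        intro: measure_pmf.finite_measure_axioms)
  also have "\<dots> = measure_pmf.expectation M (\<lambda>x. measure_pmf.expectation (K x) f)"
    by (intro integral_cong_AE) (auto simp: AE_measure_pmf_iff g_def intro!: integral_cong_AE)
  finally show ?thesis .
qed

text \<open>
  The error in evaluating \<open>g\<close> at \<open>x\<close> instead of averaging it comes only from the mass that has
  left \<open>x\<close>. This turns the continuity of \<open>h \<mapsto> P h x\<close> at \<open>h = 0\<close> into uniform continuity in time.
\<close>

lemma expectation_minus_point_le:
  fixes g :: "'a \<Rightarrow> real"
  assumes B: "\<And>y. y \<in> set_pmf M \<Longrightarrow> \<bar>g y\<bar> \<le> B" and gx: "\<bar>g x\<bar> \<le> B"
  shows "\<bar>measure_pmf.expectation M g - g x\<bar> \<le> 2 * B * (1 - pmf M x)"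
proof -
  have int: "integrable (measure_pmf M) g"
    using B by (rule integrable_pmf_bounded)
  have "measure_pmf.expectation M g - g x = measure_pmf.expectation M (\<lambda>y. g y - g x)"
    using int by simp
  also have "\<bar>\<dots>\<bar> \<le> measure_pmf.expectation M (\<lambda>y. \<bar>g y - g x\<bar>)"
    by (rule integral_abs_bound)
  also have "\<dots> \<le> measure_pmf.expectation M (\<lambda>y. 2 * B * (1 - indicator {x} y))"
  proof (rule integral_mono_AE)
    show "integrable (measure_pmf M) (\<lambda>y. \<bar>g y - g x\<bar>)"
      using int by (intro integrable_abs) auto
    show "integrable (measure_pmf M) (\<lambda>y. 2 * B * (1 - indicator {x} y))"
      by (rule integrable_pmf_bounded[where B = "\<bar>2 * B\<bar>"]) (auto simp: indicator_def)
    have "\<bar>g y - g x\<bar> \<le> 2 * B * (1 - indicator {x} y)" if "y \<in> set_pmf M" for y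
      using B[OF that] gx by (cases "y = x") auto
    then show "AE y in measure_pmf M. \<bar>g y - g x\<bar> \<le> 2 * B * (1 - indicator {x} y)"
      by (auto simp: AE_measure_pmf_iff)
  qed
  also have "\<dots> = 2 * B * (1 - pmf M x)"
  proof -
    have "measure_pmf.expectation M (\<lambda>y. 1 - indicator {x} y) = 1 - pmf M x"
      by (subst Bochner_Integration.integral_diff)
        (auto simp: measure_pmf_single intro!: integrable_pmf_bounded[where B = 1])
    then show ?thesis
      by simp
  qed
  finally show ?thesis .
qed

lemma pmf_integrable_count_space:
  fixes g :: "'a \<Rightarrow> real"
  assumes "integrable (measure_pmf M) g"
  shows "integrable (count_space UNIV) (\<lambda>x. pmf M x * g x)"
  using assms unfolding measure_pmf_eq_density by (subst (asm) integrable_density) auto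

lemma pmf_expectation_count_space:
  fixes g :: "'a \<Rightarrow> real"
  shows "measure_pmf.expectation M g = (\<integral>x. pmf M x * g x \<partial>count_space UNIV)"
  unfolding measure_pmf_eq_density by (subst integral_density) auto

lemma pmf_nat_sums_1:
  fixes p :: "nat pmf"
  shows "pmf p sums 1"
  using sums_integral_count_space_nat[OF pmf_integrable_count_space[of p "\<lambda>_. 1"]]
    pmf_expectation_count_space[of p "\<lambda>_. 1"] by simp

lemma sum_pmf_le_expectation:
  fixes f :: "'a \<Rightarrow> real"
  assumes "finite F" and f: "\<And>x. x \<in> set_pmf M \<Longrightarrow> f x \<ge> 0" and int: "integrable (measure_pmf M) f"
  shows "(\<Sum>x\<in>F. f x * pmf M x) \<le> measure_pmf.expectation M f"
proof -
  have "(\<Sum>x\<in>F. f x * pmf M x) = (\<Sum>x\<in>F. (f x * indicator F x) * pmf M x)"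
    by simp
  also have "\<dots> = measure_pmf.expectation M (\<lambda>x. f x * indicator F x)"
    using \<open>finite F\<close> by (subst integral_measure_pmf_real[of F]) (auto simp: indicator_def)
  also have "\<dots> \<le> measure_pmf.expectation M f"
    using f int by (intro integral_mono_AE integrable_real_mult_indicator)
      (auto simp: AE_measure_pmf_iff indicator_def)
  finally show ?thesis .
qed

text \<open>
  Monotone convergence in the form used below: moments of an unbounded function are bounded through
  approximations from below, and integrability comes out of the bound.
\<close>

lemma pmf_expectation_le_of_increasing:
  fixes f :: "nat \<Rightarrow> 'a \<Rightarrow> real"
  assumes int: "\<And>n. integrable (measure_pmf M) (f n)"
    and mono: "\<And>m n x. m \<le> n \<Longrightarrow> x \<in> set_pmf M \<Longrightarrow> f m x \<le> f n x"
    and nonneg: "\<And>n x. x \<in> set_pmf M \<Longrightarrow> 0 \<le> f n x"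
    and lim: "\<And>x. x \<in> set_pmf M \<Longrightarrow> (\<lambda>n. f n x) \<longlonglongrightarrow> V x"
    and bound: "\<And>n. measure_pmf.expectation M (f n) \<le> B"
  shows "integrable (measure_pmf M) V \<and> measure_pmf.expectation M V \<le> B"
proof -
  define s where "s n = measure_pmf.expectation M (f n)" for n
  have "incseq s"
    unfolding s_def
    by (intro incseq_SucI integral_mono_AE int) (auto simp: AE_measure_pmf_iff mono)
  moreover have s_le: "s n \<le> B" for n
    using bound by (simp add: s_def)
  ultimately obtain L where L: "s \<longlonglongrightarrow> L"
    using incseq_convergent by blast
  have "L \<le> B"
    using L s_le by (intro LIMSEQ_le_const2) auto
  have "AE x in measure_pmf M. incseq (\<lambda>n. f n x)" "AE x in measure_pmf M. 0 \<le> f n x"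
    "AE x in measure_pmf M. (\<lambda>n. f n x) \<longlonglongrightarrow> V x" for n
    using mono nonneg lim by (auto simp: AE_measure_pmf_iff incseq_def)
  from integral_monotone_convergence_nonneg[OF int this L[unfolded s_def]]
  show ?thesis
    using \<open>L \<le> B\<close> by auto
qed

lemma pmf_moment_le_if_exhaustion:
  fixes V :: "'a \<Rightarrow> real" and F :: "nat \<Rightarrow> 'a set"
  assumes F: "\<And>n. finite (F n)" "mono F" "set_pmf M \<subseteq> (\<Union>n. F n)"
    and V: "\<And>x. x \<in> set_pmf M \<Longrightarrow> V x \<ge> 0"
    and bound: "\<And>n. (\<Sum>x\<in>F n. V x * pmf M x) \<le> B"
  shows "integrable (measure_pmf M) V \<and> measure_pmf.expectation M V \<le> B"
proof -
  define f where "f n x = V x * indicator (F n) x" for n x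
  have f_sum: "measure_pmf.expectation M (f n) = (\<Sum>x\<in>F n. V x * pmf M x)" for n
    unfolding f_def using F(1) by (subst integral_measure_pmf_real[of "F n"]) (auto simp: indicator_def)
  have f_int: "integrable (measure_pmf M) (f n)" for n
  proof (rule integrable_pmf_bounded)
    show "\<bar>f n x\<bar> \<le> (\<Sum>y\<in>F n. \<bar>V y\<bar>)" for x
      using F(1) member_le_sum[of x "F n" "\<lambda>y. \<bar>V y\<bar>"]
      by (auto simp: f_def indicator_def sum_nonneg)
  qed
  show ?thesis
  proof (rule pmf_expectation_le_of_increasing[where f = f])
    show "f m x \<le> f n x" if "m \<le> n" "x \<in> set_pmf M" for m n x
      using monoD[OF F(2) that(1)] V[OF that(2)] by (auto simp: f_def indicator_def)
    show "0 \<le> f n x" if "x \<in> set_pmf M" for n x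
      using V[OF that] by (simp add: f_def)
    show "(\<lambda>n. f n x) \<longlonglongrightarrow> V x" if x: "x \<in> set_pmf M" for x
    proof (rule tendsto_eventually)
      obtain n where "x \<in> F n"
        using F(3) x by blast
      then show "\<forall>\<^sub>F k in sequentially. f k x = V x"
        using monoD[OF F(2)]
        by (intro eventually_sequentiallyI[of n]) (auto simp: f_def indicator_def)
    qed
    show "measure_pmf.expectation M (f n) \<le> B" for n
      using bound by (simp add: f_sum)
  qed (rule f_int)
qed

lemma pmf_moment_le_if_truncated:
  fixes V :: "'a \<Rightarrow> real"
  assumes V: "\<And>x. V x \<ge> 0" and bound: "\<And>n :: nat. measure_pmf.expectation M (\<lambda>x. min (V x) (real n)) \<le> B"
  shows "integrable (measure_pmf M) V \<and> measure_pmf.expectation M V \<le> B"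
proof (rule pmf_expectation_le_of_increasing[where f = "\<lambda>n x. min (V x) (real n)"])
  show "integrable (measure_pmf M) (\<lambda>x. min (V x) (real n))" for n
    using V by (intro integrable_pmf_bounded[where B = "real n"]) auto
  show "(\<lambda>n. min (V x) (real n)) \<longlonglongrightarrow> V x" for x
  proof (rule tendsto_eventually)
    obtain n :: nat where "V x \<le> real n"
      using real_arch_simple by blast
    then show "\<forall>\<^sub>F k in sequentially. min (V x) (real k) = V x"
      by (intro eventually_sequentiallyI[of n]) auto
  qed
qed (use V bound in auto)

text \<open>
  Integrability of \<open>W\<close> after the step is a conclusion, so the iterated integral is computed with values
  in the extended nonnegative reals.
\<close>

lemma drift_preserves_moment_bound:
  fixes K :: "'a \<Rightarrow> 'b pmf" and V :: "'a \<Rightarrow> real" and W :: "'b \<Rightarrow> real"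
  assumes W: "\<And>y. y \<in> set_pmf (bind_pmf M K) \<Longrightarrow> W y \<ge> 0"
    and drift: "\<And>x. x \<in> set_pmf M \<Longrightarrow>
        integrable (measure_pmf (K x)) W \<and> measure_pmf.expectation (K x) W \<le> V x"
    and int: "integrable (measure_pmf M) V"
  shows "integrable (measure_pmf (bind_pmf M K)) W
    \<and> measure_pmf.expectation (bind_pmf M K) W \<le> measure_pmf.expectation M V"
proof -
  have inner: "(\<integral>\<^sup>+y. ennreal (W y) \<partial>K x) = ennreal (measure_pmf.expectation (K x) W)"
    and nonneg: "0 \<le> measure_pmf.expectation (K x) W" if "x \<in> set_pmf M" for x
  proof -
    have "AE y in measure_pmf (K x). 0 \<le> W y"
      using W that by (auto simp: AE_measure_pmf_iff)
    then show "(\<integral>\<^sup>+y. ennreal (W y) \<partial>K x) = ennreal (measure_pmf.expectation (K x) W)"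
      and "0 \<le> measure_pmf.expectation (K x) W"
      using drift[OF that] by (auto simp: nn_integral_eq_integral integral_nonneg_AE)
  qed
  have V: "0 \<le> V x" if "x \<in> set_pmf M" for x
    using nonneg[OF that] drift[OF that] by linarith
  have "(\<integral>\<^sup>+y. ennreal (W y) \<partial>bind_pmf M K) = (\<integral>\<^sup>+x. \<integral>\<^sup>+y. ennreal (W y) \<partial>K x \<partial>M)"
    by simp
  also have "\<dots> \<le> (\<integral>\<^sup>+x. ennreal (V x) \<partial>M)"
    by (rule nn_integral_mono_AE) (auto simp: AE_measure_pmf_iff inner drift ennreal_leI)
  also have "\<dots> = ennreal (measure_pmf.expectation M V)"
    using V by (intro nn_integral_eq_integral int) (auto simp: AE_measure_pmf_iff)
  finally have le: "(\<integral>\<^sup>+y. ennreal (W y) \<partial>bind_pmf M K) \<le> ennreal (measure_pmf.expectation M V)" .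
  have W': "AE y in measure_pmf (bind_pmf M K). 0 \<le> W y"
    using W by (simp add: AE_measure_pmf_iff)
  have intW: "integrable (measure_pmf (bind_pmf M K)) W"
    using le_less_trans[OF le ennreal_less_top] by (intro integrableI_nonneg W') auto
  moreover have "measure_pmf.expectation (bind_pmf M K) W \<le> measure_pmf.expectation M V"
  proof -
    have "0 \<le> measure_pmf.expectation M V"
      using V by (intro integral_nonneg_AE) (auto simp: AE_measure_pmf_iff)
    then show ?thesis
      using le[unfolded nn_integral_eq_integral[OF intW W']] by (simp add: ennreal_le_iff)
  qed
  ultimately show ?thesis ..
qed

section \<open>Markov semigroups with a pointwise generator\<close>

lemma semigroup_expectation_add:
  fixes f :: "'a \<Rightarrow> real"
  assumes P: "markov_semigroup S P" and B: "\<forall>y\<in>S. \<bar>f y\<bar> \<le> B"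
    and "s \<ge> 0" "t \<ge> 0" "x \<in> S"
  shows "measure_pmf.expectation (P (s + t) x) f
       = measure_pmf.expectation (P s x) (\<lambda>y. measure_pmf.expectation (P t y) f)"
proof -
  have eq: "P (s + t) x = bind_pmf (P s x) (P t)"
    using assms unfolding markov_semigroup_def by blast
  have "set_pmf (P (s + t) x) \<subseteq> S"
    using assms unfolding markov_semigroup_def by (meson add_nonneg_nonneg)
  then show ?thesis
    unfolding eq using B by (intro expectation_bind_pmf[where B = B]) blast
qed

lemma semigroup_expectation_bounded:
  fixes f :: "'a \<Rightarrow> real"
  assumes P: "markov_semigroup S P" and B: "\<forall>y\<in>S. \<bar>f y\<bar> \<le> B"
    and "t \<ge> 0" "x \<in> S"
  shows "\<bar>measure_pmf.expectation (P t x) f\<bar> \<le> B"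
  using assms unfolding markov_semigroup_def by (intro abs_expectation_pmf_le) blast

text \<open>
  The generator limit for the indicator of \<open>x\<close> is finite, so its numerator has to vanish.
\<close>

lemma semigroup_stay_tendsto_1:
  assumes "has_generator S P L" and "x \<in> S"
  shows "((\<lambda>h. pmf (P h x) x) \<longlongrightarrow> 1) (at_right 0)"
proof -
  define f :: "'a \<Rightarrow> real" where "f = indicator {x}"
  have "bounded (f ` S)"
    by (rule boundedI[where B = 1]) (auto simp: f_def indicator_def)
  then have "((\<lambda>h. (measure_pmf.expectation (P h x) f - f x) / h) \<longlongrightarrow> L f x) (at_right 0)"
    using assms unfolding has_generator_def by blast
  then have "((\<lambda>h. (pmf (P h x) x - 1) / h) \<longlongrightarrow> L f x) (at_right 0)"
    by (simp add: f_def measure_pmf_single)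
  then have "((\<lambda>h. (pmf (P h x) x - 1) / h * h) \<longlongrightarrow> L f x * 0) (at_right 0)"
    by (intro tendsto_mult tendsto_ident_at)
  moreover have "\<forall>\<^sub>F h in at_right (0::real).
      (pmf (P h x) x - 1) / h * h = pmf (P h x) x - 1"
    by (rule eventually_at_rightI[of 0 1]) auto
  ultimately have "((\<lambda>h. pmf (P h x) x - 1) \<longlongrightarrow> L f x * 0) (at_right 0)"
    by (rule Lim_transform_eventually)
  then have "((\<lambda>h. pmf (P h x) x - 1 + 1) \<longlongrightarrow> L f x * 0 + 1) (at_right 0)"
    by (intro tendsto_add tendsto_const)
  then show ?thesis
    by simp
qed

text \<open>
  By the semigroup law \<open>P (t + h) f - P t f\<close> at \<open>x\<close> is the difference between the mean of the bounded function
  \<open>P t f\<close> under \<open>P h x\<close> and its value at \<open>x\<close>; the resulting modulus of continuity does not depend on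
  \<open>t\<close>, which gives continuity from the left as well as from the right.
\<close>

lemma semigroup_expectation_continuous:
  fixes f :: "'a \<Rightarrow> real"
  assumes P: "markov_semigroup S P" and gen: "has_generator S P L"
    and B: "\<forall>y\<in>S. \<bar>f y\<bar> \<le> B" and x: "x \<in> S"
  shows "continuous_on {0..} (\<lambda>t. measure_pmf.expectation (P t x) f)"
proof -
  define u where "u = (\<lambda>t y. measure_pmf.expectation (P t y) f)"
  have step: "\<bar>u (t + h) x - u t x\<bar> \<le> 2 * B * (1 - pmf (P h x) x)" if "t \<ge> 0" "h \<ge> 0" for t h
  proof -
    have "set_pmf (P h x) \<subseteq> S"
      using P that x unfolding markov_semigroup_def by blast
    moreover have "u (t + h) x = measure_pmf.expectation (P h x) (u t)"
      using semigroup_expectation_add[OF P B, of h t x] that x by (simp add: u_def add.commute)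
    ultimately show ?thesis
      using expectation_minus_point_le[where M = "P h x" and g = "u t" and B = B and x = x]
        semigroup_expectation_bounded[OF P B that(1)] x unfolding u_def by auto
  qed
  have cont: "continuous_on {0..} (\<lambda>t. u t x)"
    unfolding continuous_on_iff
  proof (intro ballI allI impI)
    fix t e :: real assume t: "t \<in> {0..}" and "e > 0"
    have "((\<lambda>h. 2 * B * (1 - pmf (P h x) x)) \<longlongrightarrow> 2 * B * (1 - 1)) (at_right 0)"
      by (intro tendsto_intros semigroup_stay_tendsto_1[OF gen x])
    then have "\<forall>\<^sub>F h in at_right 0. 2 * B * (1 - pmf (P h x) x) < e"
      using \<open>e > 0\<close> by (intro order_tendstoD(2)) auto
    then obtain d where d: "d > 0" "\<And>h. 0 < h \<Longrightarrow> h < d \<Longrightarrow> 2 * B * (1 - pmf (P h x) x) < e"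
      unfolding eventually_at_right_field by auto
    have "dist (u t' x) (u t x) < e" if "t' \<in> {0..}" "dist t' t < d" for t'
    proof -
      consider "t' = t" | "t' > t" | "t' < t"
        by linarith
      then show ?thesis
      proof cases
        case 1
        then show ?thesis using \<open>e > 0\<close> by simp
      next
        case 2
        then show ?thesis
          using step[of t "t' - t"] d(2)[of "t' - t"] t that by (auto simp: dist_real_def)
      next
        case 3
        then show ?thesis
          using step[of t' "t - t'"] d(2)[of "t - t'"] t that by (auto simp: dist_real_def)
      qed
    qed
    then show "\<exists>d>0. \<forall>t'\<in>{0..}. dist t' t < d \<longrightarrow> dist (u t' x) (u t x) < e"
      using d(1) by blast
  qed
  then show ?thesis
    by (simp add: u_def)
qed

text \<open>
  Kolmogorov's backward equation, as a right derivative: \<open>P t f\<close> is bounded, hence an admissible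
  test function for the generator at time \<open>0\<close>.
\<close>

lemma semigroup_backward_equation:
  fixes f :: "'a \<Rightarrow> real"
  assumes P: "markov_semigroup S P" and gen: "has_generator S P L"
    and B: "\<forall>y\<in>S. \<bar>f y\<bar> \<le> B" and x: "x \<in> S" and t: "t \<ge> 0"
  shows "((\<lambda>s. measure_pmf.expectation (P s x) f) has_real_derivative
      L (\<lambda>y. measure_pmf.expectation (P t y) f) x) (at_right t)"
proof -
  define u where "u = (\<lambda>t y. measure_pmf.expectation (P t y) f)"
  have "\<bar>u t y\<bar> \<le> B" if "y \<in> S" for y
    using semigroup_expectation_bounded[OF P B t that] by (simp only: u_def)
  then have "bounded (u t ` S)"
    by (intro boundedI[where B = B]) auto
  then have "((\<lambda>h. (measure_pmf.expectation (P h x) (u t) - u t x) / h) \<longlongrightarrow> L (u t) x) (at_right 0)"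
    using gen x unfolding has_generator_def by blast
  moreover have "\<forall>\<^sub>F h in at_right (0::real). (measure_pmf.expectation (P h x) (u t) - u t x) / h
      = (u (t + h) x - u t x) / h"
    using semigroup_expectation_add[OF P B _ t x]
    by (intro eventually_at_rightI[of 0 1]) (auto simp: u_def add.commute)
  ultimately have "((\<lambda>h. (u (t + h) x - u t x) / h) \<longlongrightarrow> L (u t) x) (at_right 0)"
    by (rule Lim_transform_eventually)
  then have "((\<lambda>s. (u s x - u t x) / (s - t)) \<longlongrightarrow> L (u t) x) (at_right t)"
    unfolding filterlim_at_right_to_0[of _ _ t] by (simp add: add.commute)
  then show ?thesis
    unfolding has_field_derivative_iff u_def .
qed

text \<open>
  A coercive supersolution \<open>w\<close> of the backward equation dominates \<open>P t f\<close>. The hypothesis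
  \<open>max_principle\<close> is what the argument needs of the operator \<open>L\<close>: if \<open>u\<close> touches \<open>w + c\<close> from below, then
  \<open>L u\<close> is at most \<open>L w\<close> at the contact point. Perturb \<open>w\<close> by \<open>e * (1 + t)\<close> and let \<open>r\<close> be the infimum of
  the times at which domination fails. By continuity it still holds at time \<open>r\<close>, and right of \<open>r\<close> it persists,
  because at a contact point the gap has a positive right derivative. Right derivatives suffice, and
  \<open>w\<close> may be unbounded, which is what makes exponential moments accessible.
\<close>

lemma semigroup_comparison:
  fixes f :: "'a \<Rightarrow> real" and w w' :: "real \<Rightarrow> 'a \<Rightarrow> real"
  assumes P: "markov_semigroup S P" and gen: "has_generator S P L"
    and B: "\<forall>y\<in>S. \<bar>f y\<bar> \<le> B"
    and init: "\<And>y. y \<in> S \<Longrightarrow> f y \<le> w 0 y"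
    and deriv: "\<And>t y. 0 \<le> t \<Longrightarrow> t \<le> T \<Longrightarrow> y \<in> S \<Longrightarrow>
        ((\<lambda>s. w s y) has_real_derivative w' t y) (at t)"
    and super: "\<And>t y. 0 \<le> t \<Longrightarrow> t \<le> T \<Longrightarrow> y \<in> S \<Longrightarrow> L (w t) y \<le> w' t y"
    and max_principle: "\<And>t u c y. \<lbrakk>0 \<le> t; t \<le> T; y \<in> S; bounded (u ` S);
        \<And>z. z \<in> S \<Longrightarrow> u z \<le> w t z + c; u y = w t y + c\<rbrakk> \<Longrightarrow> L u y \<le> L (w t) y"
    and coercive: "\<And>m. finite {y\<in>S. \<exists>t\<in>{0..T}. w t y \<le> m}"
    and T: "T \<ge> 0" and x: "x \<in> S"
  shows "measure_pmf.expectation (P T x) f \<le> w T x"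
proof -
  define u where "u = (\<lambda>t y. measure_pmf.expectation (P t y) f)"
  have u_bound: "\<bar>u t y\<bar> \<le> B" if "t \<ge> 0" "y \<in> S" for t y
    using semigroup_expectation_bounded[OF P B that] by (simp only: u_def)
  have u_0: "u 0 y = f y" if "y \<in> S" for y
    using P that unfolding markov_semigroup_def by (simp add: u_def)
  have u_cont: "continuous_on {0..} (\<lambda>t. u t y)" if "y \<in> S" for y
    using semigroup_expectation_continuous[OF P gen B that] by (simp only: u_def)
  have u_deriv: "((\<lambda>s. u s y) has_real_derivative L (u t) y) (at_right t)"
    if "y \<in> S" "t \<ge> 0" for t y
    using semigroup_backward_equation[OF P gen B that] unfolding u_def .
  have *: "u T x \<le> w T x + e * (1 + T)" if e: "e > 0" for e
  proof (rule ccontr)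
    assume violated: "\<not> u T x \<le> w T x + e * (1 + T)"
    \<comment> \<open>The slope \<open>e\<close> of the correction makes the derivative at a contact point strictly positive.\<close>
    define g where "g t y = w t y + e * (1 + t) - u t y" for t y
    define bad where "bad = {t\<in>{0..T}. \<exists>y\<in>S. g t y < 0}"
    have "T \<in> bad"
      using violated T x by (auto simp: bad_def g_def intro!: bexI[of _ x])
    have bdd: "bdd_below bad"
      by (rule bdd_belowI[of _ 0]) (auto simp: bad_def)
    define r where "r = Inf bad"
    have r: "0 \<le> r" "r \<le> T"
      using \<open>T \<in> bad\<close> bdd unfolding r_def
      by (auto intro!: cInf_greatest cInf_lower simp: bad_def)
    have before: "g t y \<ge> 0" if "0 \<le> t" "t < r" "y \<in> S" for t y
    proof -
      have "t \<notin> bad"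
        using cInf_lower[OF _ bdd, of t] that unfolding r_def by force
      then show ?thesis
        using that r by (auto simp: bad_def not_less)
    qed
    have g_deriv: "((\<lambda>s. g s y) has_real_derivative (w' t y + e - L (u t) y)) (at_right t)"
      if "0 \<le> t" "t \<le> T" "y \<in> S" for t y
    proof -
      have "((\<lambda>s. w s y) has_real_derivative w' t y) (at_right t)"
        using DERIV_subset[OF deriv[OF that]] by simp
      moreover have "((\<lambda>s. e * (1 + s)) has_real_derivative e) (at_right t)"
        by (auto intro!: derivative_eq_intros)
      ultimately show ?thesis
        unfolding g_def by (intro DERIV_diff DERIV_add u_deriv that(1) that(3))
    qed
    have g_cont: "continuous_on {0..T} (\<lambda>t. g t y)" if "y \<in> S" for y
    proof -
      have "continuous_on {0..T} (\<lambda>s. w s y)"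
        using deriv that
        by (intro continuous_at_imp_continuous_on ballI) (auto intro: DERIV_isCont)
      moreover have "continuous_on {0..T} (\<lambda>s. u s y)"
        by (rule continuous_on_subset[OF u_cont[OF that]]) auto
      ultimately show ?thesis
        unfolding g_def by (intro continuous_intros)
    qed
    have at_r: "g r y \<ge> 0" if y: "y \<in> S" for y
    proof (cases "r = 0")
      case True
      then show ?thesis
        using init[OF y] u_0[OF y] e by (simp add: g_def)
    next
      case False
      then have "r > 0" using r by simp
      have "continuous_on {0..r} (\<lambda>t. g t y)"
        by (rule continuous_on_subset[OF g_cont[OF y]]) (use r in auto)
      moreover have "closure {0..<r} = {0..r}"
        using \<open>r > 0\<close> by simp
      ultimately show ?thesis
        using continuous_ge_on_closure[of "{0..<r}" "\<lambda>t. g t y" r 0] before y \<open>r > 0\<close> by auto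
    qed
    \<comment> \<open>At a contact point the maximum principle pushes the gap up, elsewhere continuity keeps it
      positive, so no single state is violated right after time \<open>r\<close>.\<close>
    have after: "\<forall>\<^sub>F t in at_right r. g t y \<ge> 0" if y: "y \<in> S" for y
    proof (cases "g r y = 0")
      case True
      have "L (u r) y \<le> L (w r) y"
      proof (rule max_principle[where c = "e * (1 + r)"])
        show "bounded (u r ` S)"
          by (rule boundedI[where B = B]) (use u_bound r in auto)
        show "u r z \<le> w r z + e * (1 + r)" if "z \<in> S" for z
          using at_r[OF that] by (simp add: g_def)
        show "u r y = w r y + e * (1 + r)"
          using True by (simp add: g_def)
      qed (use r y in auto)
      then have "w' r y + e - L (u r) y > 0"
        using super[OF r y] e by linarith
      then have "\<exists>d>0. \<forall>h>0. r + h \<in> {r<..} \<longrightarrow> h < d \<longrightarrow> g r y < g (r + h) y"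
        by (rule has_real_derivative_pos_inc_right[OF g_deriv[OF r y]])
      then obtain d where d: "d > 0" "\<And>h. 0 < h \<Longrightarrow> h < d \<Longrightarrow> g r y < g (r + h) y"
        by auto
      show ?thesis
      proof (rule eventually_at_rightI[of r "r + d"])
        show "g t y \<ge> 0" if "t \<in> {r<..<r + d}" for t
          using d(2)[of "t - r"] that True by simp
      qed (use d in simp)
    next
      case False
      have "((\<lambda>t. g t y) \<longlongrightarrow> g r y) (at_right r)"
        using DERIV_continuous[OF g_deriv[OF r y]] by (simp add: continuous_within)
      then have "\<forall>\<^sub>F t in at_right r. g t y > 0"
        using False at_r[OF y] by (intro order_tendstoD(1)) auto
      then show ?thesis
        by eventually_elim simp
    qed
    \<comment> \<open>Coercivity leaves finitely many states at which a violation is possible; this makes the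
      waiting time uniform in the state.\<close>
    define K where "K = {y\<in>S. \<exists>t\<in>{0..T}. w t y \<le> B}"
    have "finite K"
      unfolding K_def by (rule coercive)
    then have "\<forall>\<^sub>F t in at_right r. \<forall>y\<in>K. g t y \<ge> 0"
      using after by (intro eventually_ball_finite) (auto simp: K_def)
    then obtain d where d: "d > r" "\<And>t. r < t \<Longrightarrow> t < d \<Longrightarrow> \<forall>y\<in>K. g t y \<ge> 0"
      unfolding eventually_at_right_field by auto
    have good: "t \<notin> bad" if "t < d" for t
    proof
      assume "t \<in> bad"
      then obtain y where y: "y \<in> S" "g t y < 0" and t: "0 \<le> t" "t \<le> T"
        by (auto simp: bad_def)
      have "w t y \<le> B"
      proof -
        have "e * (1 + t) \<ge> 0"
          using e t by simp
        then show ?thesis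
          using y(2) u_bound[OF t(1) y(1)] unfolding g_def by linarith
      qed
      then have "y \<in> K"
        using y t by (auto simp: K_def)
      then show False
        using d(2)[of t] before[of t y] at_r[of y] y t \<open>t < d\<close>
        by (cases t r rule: linorder_cases) force+
    qed
    have "d \<le> Inf bad"
      using \<open>T \<in> bad\<close> good by (intro cInf_greatest) (auto simp: not_less[symmetric])
    then show False
      using d(1) by (simp add: r_def)
  qed
  have "u T x \<le> w T x + e" if "e > 0" for e
  proof -
    have "e / (1 + T) > 0" "e / (1 + T) * (1 + T) = e"
      using that T by auto
    with *[of "e / (1 + T)"] show ?thesis
      by simp
  qed
  then have "u T x \<le> w T x"
    by (rule field_le_epsilon)
  then show ?thesis
    by (simp add: u_def)
qed

lemma semigroup_pmf_add_ge:
  assumes P: "markov_semigroup S P" and "s \<ge> 0" "t \<ge> 0" "x \<in> S"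
  shows "pmf (P s x) y * pmf (P t y) z \<le> pmf (P (s + t) x) z"
proof -
  have "P (s + t) x = bind_pmf (P s x) (P t)"
    using assms unfolding markov_semigroup_def by blast
  then show ?thesis
    using sum_pmf_le_expectation[of "{y}" "P s x" "\<lambda>y. pmf (P t y) z"]
    by (simp add: pmf_bind mult.commute integrable_pmf_bounded[where B = 1] pmf_le_1)
qed

text \<open>
  Staying put has positive probability over a short time, and a long time is a concatenation of short ones.
\<close>

lemma semigroup_stay_pos:
  assumes P: "markov_semigroup S P" and gen: "has_generator S P L" and x: "x \<in> S" and t: "t \<ge> 0"
  shows "pmf (P t x) x > 0"
proof -
  have "\<forall>\<^sub>F h in at_right 0. pmf (P h x) x > 0"
    using semigroup_stay_tendsto_1[OF gen x] by (rule order_tendstoD(1)) simp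
  then obtain d where d: "d > 0" "\<And>h. 0 < h \<Longrightarrow> h < d \<Longrightarrow> pmf (P h x) x > 0"
    unfolding eventually_at_right_field by auto
  have P_0: "pmf (P 0 x) x > 0"
    using P x unfolding markov_semigroup_def by simp
  obtain n :: nat where n: "t / d < real n"
    using reals_Archimedean2 by blast
  have "n > 0"
    using n t d(1) by (cases n) (auto simp: divide_less_0_iff)
  define h where "h = t / real n"
  have h: "0 \<le> h" "h < d"
    using n \<open>n > 0\<close> t d(1) by (auto simp: h_def field_simps)
  have step: "pmf (P h x) x > 0"
    using d(2) h P_0 by (cases "h = 0") auto
  have "pmf (P (real m * h) x) x > 0" for m :: nat
  proof (induction m)
    case (Suc m)
    have "0 < pmf (P (real m * h) x) x * pmf (P h x) x"
      using Suc step by simp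
    also have "\<dots> \<le> pmf (P (real m * h + h) x) x"
      using h(1) by (intro semigroup_pmf_add_ge[OF P _ _ x]) auto
    finally show ?case
      by (simp add: algebra_simps)
  qed (use P_0 in simp)
  from this[of n] show ?thesis
    using \<open>n > 0\<close> by (simp add: h_def)
qed

text \<open>
  A positive rate makes the jump possible within a short time, after which the chain may stay at \<open>y\<close>.
\<close>

lemma semigroup_jump_pos:
  assumes P: "markov_semigroup S P" and gen: "has_generator S P L"
    and x: "x \<in> S" and y: "y \<in> S" and ne: "x \<noteq> y"
    and L: "L (indicator {y}) x > 0" and t: "t > 0"
  shows "pmf (P t x) y > 0"
proof -
  have "bounded (indicator {y} ` S :: real set)"
    by (rule boundedI[where B = 1]) (auto simp: indicator_def)
  then have "((\<lambda>h. (measure_pmf.expectation (P h x) (indicator {y}) - indicator {y} x) / h)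
      \<longlongrightarrow> L (indicator {y}) x) (at_right 0)"
    using gen x unfolding has_generator_def by blast
  then have "((\<lambda>h. pmf (P h x) y / h) \<longlongrightarrow> L (indicator {y}) x) (at_right 0)"
    using ne by (simp add: measure_pmf_single)
  then have "\<forall>\<^sub>F h in at_right 0. pmf (P h x) y / h > 0"
    using L by (rule order_tendstoD(1))
  then obtain d where d: "d > 0" "\<And>h. 0 < h \<Longrightarrow> h < d \<Longrightarrow> pmf (P h x) y / h > 0"
    unfolding eventually_at_right_field by auto
  define h where "h = min d t / 2"
  have h: "0 < h" "h < d" "h < t"
    using d(1) t by (auto simp: h_def min_def)
  have "pmf (P h x) y > 0"
    using d(2)[OF h(1,2)] h(1) by (simp add: zero_less_divide_iff)
  moreover have "pmf (P (t - h) y) y > 0"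
    using h by (intro semigroup_stay_pos[OF P gen y]) simp
  ultimately have "0 < pmf (P h x) y * pmf (P (t - h) y) y"
    by simp
  also have "\<dots> \<le> pmf (P (h + (t - h)) x) y"
    using h by (intro semigroup_pmf_add_ge[OF P _ _ x]) auto
  finally show ?thesis
    by simp
qed

section \<open>Stationary laws of Markov kernels\<close>

text \<open>
  A state that is charged from everywhere in one step forces uniqueness. Let \<open>A\<close> be the set where
  \<open>\<mu>\<close> exceeds \<open>\<nu>\<close>. Stationarity of both laws makes the sum of
  \<open>(pmf \<mu> x - pmf \<nu> x) * (indicator A x - measure (K x) A)\<close> vanish, although every term is nonnegative; hence every
  term is zero. A point with \<open>\<mu> < \<nu>\<close> then never jumps into \<open>A\<close>, and one with \<open>\<mu> > \<nu>\<close> never jumps out of it,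
  so \<open>a\<close> could be neither inside nor outside \<open>A\<close>.
\<close>

lemma stationary_pmf_unique:
  fixes K :: "'a \<Rightarrow> 'a pmf"
  assumes reach: "\<And>x. x \<in> S \<Longrightarrow> pmf (K x) a > 0"
    and \<mu>: "set_pmf \<mu> \<subseteq> S" "bind_pmf \<mu> K = \<mu>"
    and \<nu>: "set_pmf \<nu> \<subseteq> S" "bind_pmf \<nu> K = \<nu>"
  shows "\<mu> = \<nu>"
proof (rule ccontr)
  assume "\<mu> \<noteq> \<nu>"
  then obtain x1 x2 where x1: "pmf \<mu> x1 < pmf \<nu> x1" and x2: "pmf \<nu> x2 < pmf \<mu> x2"
    using pmf_neq_exists_less by metis
  define A where "A = {x. pmf \<nu> x < pmf \<mu> x}"
  define f where "f = (\<lambda>x. measure (measure_pmf (K x)) A)"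
  define h where "h x = (pmf \<mu> x - pmf \<nu> x) * (indicator A x - f x)" for x
  have f: "0 \<le> f x" "f x \<le> 1" for x
    by (auto simp: f_def)
  have int: "integrable (measure_pmf \<rho>) (\<lambda>x. indicator A x - f x)" for \<rho>
  proof (rule integrable_pmf_bounded)
    show "\<bar>indicator A x - f x\<bar> \<le> 1" for x
      using f[of x] by (auto simp: indicator_def)
  qed
  \<comment> \<open>A stationary law gives the set \<open>A\<close> as much mass before a step as after it.\<close>
  have mass: "measure_pmf.expectation \<rho> (\<lambda>x. indicator A x - f x) = 0"
    if "bind_pmf \<rho> K = \<rho>" for \<rho>
  proof -
    have "measure (measure_pmf \<rho>) A = measure_pmf.expectation (bind_pmf \<rho> K) (indicator A)"
      by (simp add: that)
    also have "\<dots> = measure_pmf.expectation \<rho> f"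
      by (subst expectation_bind_pmf[where B = 1]) (auto simp: f_def indicator_def)
    finally have "measure (measure_pmf \<rho>) A = measure_pmf.expectation \<rho> f" .
    moreover have "integrable (measure_pmf \<rho>) f"
      using f by (intro integrable_pmf_bounded[where B = 1]) auto
    ultimately show ?thesis
      by (subst Bochner_Integration.integral_diff) (auto intro: integrable_pmf_bounded[where B = 1])
  qed
  have h_eq: "h x = pmf \<mu> x * (indicator A x - f x) - pmf \<nu> x * (indicator A x - f x)" for x
    by (simp add: h_def algebra_simps)
  have h_int: "integrable (count_space UNIV) h"
    unfolding h_eq by (intro Bochner_Integration.integrable_diff pmf_integrable_count_space int)
  have "(\<integral>x. h x \<partial>count_space UNIV) = 0"
    unfolding h_eq using mass[OF \<mu>(2)] mass[OF \<nu>(2)]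
    by (subst Bochner_Integration.integral_diff)
      (auto simp: pmf_expectation_count_space intro!: pmf_integrable_count_space int)
  moreover have "h x \<ge> 0" for x
    using f[of x] by (cases "x \<in> A")
      (auto simp: h_def A_def not_less intro!: mult_nonneg_nonneg mult_nonpos_nonneg)
  ultimately have h_0: "h x = 0" for x
    using integral_nonneg_eq_0_iff_AE[OF h_int] by (simp add: AE_count_space)
  \<comment> \<open>So \<open>x1\<close> never enters \<open>A\<close> and \<open>x2\<close> never leaves it, although \<open>a\<close> is within reach of both.\<close>
  have S: "x1 \<in> S" "x2 \<in> S"
  proof -
    have "pmf \<nu> x1 \<noteq> 0" "pmf \<mu> x2 \<noteq> 0"
      using x1 x2 pmf_nonneg[of \<mu> x1] pmf_nonneg[of \<nu> x2] by linarith+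
    then show "x1 \<in> S" "x2 \<in> S"
      using \<mu>(1) \<nu>(1) by (auto simp: set_pmf_iff)
  qed
  have "f x1 = 0"
    using h_0[of x1] x1 by (auto simp: h_def A_def)
  moreover have "pmf (K x1) a \<le> f x1" if "a \<in> A"
    unfolding f_def using that
    by (metis measure_pmf.finite_measure_mono measure_pmf_single sets_measure_pmf UNIV_I
        empty_subsetI insert_subset sets_UNIV)
  ultimately have "a \<notin> A"
    using reach[OF S(1)] by fastforce
  then have "A \<subseteq> - {a}"
    by blast
  then have "f x2 \<le> measure (measure_pmf (K x2)) (- {a})"
    unfolding f_def by (intro measure_pmf.finite_measure_mono) auto
  also have "\<dots> = 1 - pmf (K x2) a"
    using measure_pmf.prob_compl[of "{a}" "K x2"] by (simp add: measure_pmf_single Compl_eq_Diff_UNIV)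
  finally have "f x2 < 1"
    using reach[OF S(2)] by simp
  then show False
    using h_0[of x2] x2 by (auto simp: h_def A_def)
qed

text \<open>
  Krylov-Bogoliubov with a Foster-Lyapunov function: the drift inequality keeps the mean of \<open>V\<close> below \<open>B\<close>
  along the chain started at \<open>a\<close>. Since sublevel sets of \<open>V\<close> are finite, the Cesaro averages of the laws
  have a subsequence that converges pointwise without loss of mass. Its limit is stationary and
  inherits the bound \<open>B\<close>.
\<close>

lemma stationary_pmf_exists:
  fixes K :: "'a \<Rightarrow> 'a pmf" and V :: "'a \<Rightarrow> real"
  assumes K: "\<And>x. x \<in> S \<Longrightarrow> set_pmf (K x) \<subseteq> S" and a: "a \<in> S"
    and V: "\<And>x. x \<in> S \<Longrightarrow> V x \<ge> 0" and fin: "\<And>m. finite {x\<in>S. V x \<le> m}"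
    and drift: "\<And>x. x \<in> S \<Longrightarrow>
        integrable (measure_pmf (K x)) V \<and> measure_pmf.expectation (K x) V \<le> \<gamma> * V x + b"
    and \<gamma>: "\<gamma> \<ge> 0" and B: "V a \<le> B" "\<gamma> * B + b \<le> B"
  obtains \<mu> where "set_pmf \<mu> \<subseteq> S" "bind_pmf \<mu> K = \<mu>"
    "integrable (measure_pmf \<mu>) V" "measure_pmf.expectation \<mu> V \<le> B"
proof -
  define M where "M k = ((\<lambda>\<rho>. bind_pmf \<rho> K) ^^ k) (return_pmf a)" for k :: nat
  have M_Suc: "M (Suc k) = bind_pmf (M k) K" for k
    by (simp add: M_def)
  have M_S: "set_pmf (M k) \<subseteq> S" for k
    by (induction k) (use a K in \<open>auto simp: M_Suc, auto simp: M_def\<close>)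
  have M_V: "integrable (measure_pmf (M k)) V \<and> measure_pmf.expectation (M k) V \<le> B" for k
  proof (induction k)
    case 0
    show ?case
      using B(1) by (simp add: M_def integrable_measure_pmf_finite)
  next
    case (Suc k)
    have "integrable (measure_pmf (M (Suc k))) V \<and>
        measure_pmf.expectation (M (Suc k)) V \<le> measure_pmf.expectation (M k) (\<lambda>x. \<gamma> * V x + b)"
      unfolding M_Suc
      by (rule drift_preserves_moment_bound) (use Suc M_S[of k] M_S[of "Suc k"] drift V in \<open>auto simp: M_Suc\<close>)
    moreover have "measure_pmf.expectation (M k) (\<lambda>x. \<gamma> * V x + b)
        = \<gamma> * measure_pmf.expectation (M k) V + b"
      using Suc by simp
    moreover have "\<dots> \<le> \<gamma> * B + b"
      using Suc \<gamma> by (intro add_right_mono mult_left_mono) auto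
    ultimately show ?case
      using B(2) by linarith
  qed
  define F where "F n = {x\<in>S. V x \<le> real n}" for n :: nat
  have F: "finite (F n)" "F n \<subseteq> S" for n
    using fin by (auto simp: F_def)
  have F_mono: "mono F"
    by (auto simp: mono_def F_def)
  have F_S: "(\<Union>n. F n) = S"
    by (auto simp: F_def intro: real_arch_simple)
  \<comment> \<open>Markov's inequality: no mass escapes to infinity along \<open>M\<close>.\<close>
  have tight: "(\<Sum>x\<in>F n. pmf (M k) x) \<ge> 1 - B / real n" if "n > 0" for n k
  proof -
    have "1 - B / real n \<le> measure_pmf.expectation (M k) (\<lambda>x. 1 - V x / real n)"
      using M_V[of k] that by (simp add: divide_right_mono)
    also have "\<dots> \<le> measure_pmf.expectation (M k) (indicator (F n))"
    proof (rule integral_mono_AE)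
      show "AE x in measure_pmf (M k). 1 - V x / real n \<le> indicator (F n) x"
        using M_S[of k] V that by (auto simp: AE_measure_pmf_iff F_def indicator_def divide_simps)
    qed (use M_V[of k] in \<open>auto intro!: integrable_pmf_bounded[where B = 1] simp: indicator_def\<close>)
    also have "\<dots> = (\<Sum>x\<in>F n. pmf (M k) x)"
      using F(1) by (simp add: measure_measure_pmf_finite)
    finally show ?thesis .
  qed
  define \<nu> where "\<nu> n x = (\<Sum>k\<le>n. pmf (M k) x) / real (Suc n)" for n :: nat and x
  have \<nu>_nonneg: "\<nu> n x \<ge> 0" for n x
    by (auto simp: \<nu>_def intro!: sum_nonneg divide_nonneg_nonneg)
  have \<nu>_sum: "(\<Sum>x\<in>G. f x * \<nu> n x) = (\<Sum>k\<le>n. \<Sum>x\<in>G. f x * pmf (M k) x) / real (Suc n)" for G f n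
  proof -
    have "(\<Sum>x\<in>G. f x * \<nu> n x) = (\<Sum>x\<in>G. \<Sum>k\<le>n. f x * pmf (M k) x) / real (Suc n)"
      by (simp add: \<nu>_def sum_distrib_left sum_divide_distrib)
    then show ?thesis
      by (subst (asm) sum.swap)
  qed
  have mean_le: "(\<Sum>k\<le>n. c k) / real (Suc n) \<le> C" if "\<And>k. c k \<le> C" for c :: "nat \<Rightarrow> real" and C n
    using sum_bounded_above[of "{..n}" c C] that by (simp add: field_simps)
  have mean_ge: "C \<le> (\<Sum>k\<le>n. c k) / real (Suc n)" if "\<And>k. C \<le> c k" for c :: "nat \<Rightarrow> real" and C n
    using sum_bounded_below[of "{..n}" C c] that by (simp add: field_simps)
  have "countable S"
    unfolding F_S[symmetric] using F(1) by (intro countable_UN) (auto intro: countable_finite)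
  moreover have "norm (\<nu> n x) \<le> 1" for n x
  proof -
    have "\<nu> n x \<le> 1"
      unfolding \<nu>_def by (rule mean_le) (rule pmf_le_1)
    then show ?thesis
      using \<nu>_nonneg[of n x] by simp
  qed
  ultimately obtain r where r: "strict_mono (r :: nat \<Rightarrow> nat)"
    "\<And>x. x \<in> S \<Longrightarrow> \<exists>l. (\<lambda>n. \<nu> (r n) x) \<longlonglongrightarrow> l"
    using function_convergent_subsequence[of S \<nu> 1] by blast
  define l where "l x = (if x \<in> S then lim (\<lambda>n. \<nu> (r n) x) else 0)" for x
  have l_lim: "(\<lambda>n. \<nu> (r n) x) \<longlonglongrightarrow> l x" if "x \<in> S" for x
    using r(2)[OF that] that by (auto simp: l_def convergent_LIMSEQ_iff[symmetric] convergent_def)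
  have l_nonneg: "l x \<ge> 0" for x
  proof (cases "x \<in> S")
    case True
    then show ?thesis
      using \<nu>_nonneg by (intro LIMSEQ_le_const[OF l_lim]) auto
  qed (simp add: l_def)
  have l_sum: "(\<lambda>n. \<Sum>x\<in>G. f x * \<nu> (r n) x) \<longlonglongrightarrow> (\<Sum>x\<in>G. f x * l x)" if "G \<subseteq> S" for f :: "'a \<Rightarrow> real" and G
    using that by (intro tendsto_sum tendsto_mult tendsto_const l_lim) auto
  have upper: "(\<Sum>x\<in>G. f x * l x) \<le> C"
    if "G \<subseteq> S" "\<And>k. (\<Sum>x\<in>G. f x * pmf (M k) x) \<le> C" for f :: "'a \<Rightarrow> real" and G C
    by (rule LIMSEQ_le_const2[OF l_sum[OF that(1)]]) (use mean_le[OF that(2)] \<nu>_sum in auto)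
  have lower: "C \<le> (\<Sum>x\<in>G. f x * l x)"
    if "G \<subseteq> S" "\<And>k. C \<le> (\<Sum>x\<in>G. f x * pmf (M k) x)" for f :: "'a \<Rightarrow> real" and G C
    by (rule LIMSEQ_le_const[OF l_sum[OF that(1)]]) (use mean_ge[OF that(2)] \<nu>_sum in auto)
  have l_mass: "(\<integral>\<^sup>+x. ennreal (l x) \<partial>count_space UNIV) = 1"
  proof -
    define g where "g n x = ennreal (l x) * indicator (F n) x" for n x
    have g_int: "(\<integral>\<^sup>+x. g n x \<partial>count_space UNIV) = ennreal (\<Sum>x\<in>F n. l x)" for n
    proof -
      have "(\<integral>\<^sup>+x. g n x \<partial>count_space UNIV) = (\<Sum>x\<in>F n. g n x)"
        using F(1) by (intro nn_integral_count_space') (auto simp: g_def)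
      then show ?thesis
        using l_nonneg by (simp add: g_def)
    qed
    have "incseq g"
      using monoD[OF F_mono] by (auto simp: incseq_def le_fun_def g_def indicator_def)
    have g_SUP: "(SUP n. g n x) = ennreal (l x)" for x
    proof (rule antisym)
      show "(SUP n. g n x) \<le> ennreal (l x)"
        by (rule SUP_least) (auto simp: g_def indicator_def)
      show "ennreal (l x) \<le> (SUP n. g n x)"
      proof (cases "x \<in> S")
        case True
        then obtain n where "x \<in> F n"
          using F_S by blast
        then show ?thesis
          by (intro SUP_upper2[of n]) (auto simp: g_def)
      qed (simp add: l_def)
    qed
    have "(\<lambda>n. \<Sum>x\<in>F n. l x) \<longlonglongrightarrow> 1"
    proof (rule tendsto_sandwich)
      show "\<forall>\<^sub>F n in sequentially. 1 - B / real n \<le> (\<Sum>x\<in>F n. l x)"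
        using lower[of "F _" _ "\<lambda>_. 1"] tight F(2)
        by (intro eventually_sequentiallyI[of 1]) auto
      have "(\<Sum>x\<in>F n. pmf (M k) x) \<le> 1" for n k
        using F(1) by (simp flip: measure_measure_pmf_finite)
      then show "\<forall>\<^sub>F n in sequentially. (\<Sum>x\<in>F n. l x) \<le> 1"
        using upper[of "F _" "\<lambda>_. 1" 1] F(2) by (intro always_eventually) auto
      show "(\<lambda>n. 1 - B / real n) \<longlonglongrightarrow> 1"
        by (rule tendsto_eq_intros lim_const_over_n refl | simp)+
    qed simp
    then have "(\<lambda>n. ennreal (\<Sum>x\<in>F n. l x)) \<longlonglongrightarrow> ennreal 1"
      by (rule tendsto_ennrealI)
    moreover have "(\<lambda>n. ennreal (\<Sum>x\<in>F n. l x)) \<longlonglongrightarrow> (SUP n. ennreal (\<Sum>x\<in>F n. l x))"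
    proof (rule LIMSEQ_SUP)
      show "incseq (\<lambda>n. ennreal (\<Sum>x\<in>F n. l x))"
        using monoD[OF F_mono] F(1) l_nonneg
        by (auto simp: incseq_def intro!: ennreal_leI sum_mono2)
    qed
    ultimately have "(SUP n. ennreal (\<Sum>x\<in>F n. l x)) = 1"
      using LIMSEQ_unique by fastforce
    then show ?thesis
      using nn_integral_monotone_convergence_SUP[OF \<open>incseq g\<close>, of "count_space UNIV"]
      by (simp add: g_SUP g_int)
  qed
  define \<mu> where "\<mu> = embed_pmf l"
  have pmf_\<mu>: "pmf \<mu> x = l x" for x
    unfolding \<mu>_def by (rule pmf_embed_pmf[OF l_nonneg l_mass])
  have \<mu>_S: "set_pmf \<mu> \<subseteq> S"
    by (auto simp: set_pmf_iff pmf_\<mu> l_def split: if_splits)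
  have "pmf (bind_pmf \<mu> K) y \<le> pmf \<mu> y" if y: "y \<in> S" for y
  proof -
    have fin_le: "(\<Sum>x\<in>F m. pmf (K x) y * l x) \<le> l y" for m
    proof (rule LIMSEQ_le[OF l_sum[OF F(2)]])
      \<comment> \<open>The kernel moves every law in a Cesaro average one index ahead, so only one new term enters.\<close>
      have le: "(\<Sum>x\<in>F m. pmf (K x) y * \<nu> n x) \<le> \<nu> n y + 1 / real (Suc n)" for n
      proof -
        have "(\<Sum>x\<in>F m. pmf (K x) y * pmf (M k) x) \<le> pmf (M (Suc k)) y" for k
          unfolding M_Suc pmf_bind
          by (intro sum_pmf_le_expectation F integrable_pmf_bounded[where B = 1])
             (auto simp: pmf_le_1)
        then have "(\<Sum>k\<le>n. \<Sum>x\<in>F m. pmf (K x) y * pmf (M k) x) \<le> (\<Sum>k\<le>n. pmf (M (Suc k)) y)"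
          by (rule sum_mono)
        also have "\<dots> \<le> (\<Sum>k\<le>Suc n. pmf (M k) y)"
          by (subst sum.atMost_Suc_shift) simp
        also have "\<dots> \<le> (\<Sum>k\<le>n. pmf (M k) y) + 1"
          by (simp add: pmf_le_1)
        finally have "(\<Sum>k\<le>n. \<Sum>x\<in>F m. pmf (K x) y * pmf (M k) x) / real (Suc n)
            \<le> ((\<Sum>k\<le>n. pmf (M k) y) + 1) / real (Suc n)"
          by (rule divide_right_mono) simp
        then show ?thesis
          unfolding \<nu>_sum by (simp only: \<nu>_def add_divide_distrib)
      qed
      have "(\<lambda>n. 1 / real (Suc (r n))) \<longlonglongrightarrow> 0"
        using LIMSEQ_subseq_LIMSEQ[OF LIMSEQ_Suc[OF lim_1_over_n] r(1)] by (simp add: o_def)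
      then show "(\<lambda>n. \<nu> (r n) y + 1 / real (Suc (r n))) \<longlonglongrightarrow> l y"
        using tendsto_add[OF l_lim[OF y]] by fastforce
      show "\<exists>N. \<forall>n\<ge>N. (\<Sum>x\<in>F m. pmf (K x) y * \<nu> (r n) x) \<le> \<nu> (r n) y + 1 / real (Suc (r n))"
        using le by blast
    qed
    have "measure_pmf.expectation \<mu> (\<lambda>x. pmf (K x) y) \<le> l y"
      using pmf_moment_le_if_exhaustion[of F \<mu> "\<lambda>x. pmf (K x) y" "l y"] F(1) F_mono F_S \<mu>_S fin_le
      by (auto simp: pmf_\<mu>)
    then show ?thesis
      by (simp add: pmf_bind pmf_\<mu>)
  qed
  moreover have "pmf (bind_pmf \<mu> K) y = 0" if "y \<notin> S" for y
    using that \<mu>_S K by (auto simp: pmf_eq_0_set_pmf)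
  \<comment> \<open>Both sides are probabilities, so the inequality between them is an equality.\<close>
  ultimately have "pmf (bind_pmf \<mu> K) y \<le> pmf \<mu> y" for y
    by (metis pmf_nonneg)
  then have "bind_pmf \<mu> K = \<mu>"
    using pmf_neq_exists_less by (metis not_less)
  moreover have "integrable (measure_pmf \<mu>) V \<and> measure_pmf.expectation \<mu> V \<le> B"
  proof (rule pmf_moment_le_if_exhaustion[of F])
    show "(\<Sum>x\<in>F n. V x * pmf \<mu> x) \<le> B" for n
      unfolding pmf_\<mu>
    proof (rule upper[OF F(2)])
      show "(\<Sum>x\<in>F n. V x * pmf (M k) x) \<le> B" for k
        using sum_pmf_le_expectation[OF F(1), of "M k" V n] M_V[of k] M_S[of k] V by force
    qed
    show "V x \<ge> 0" if "x \<in> set_pmf \<mu>" for x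
      using that \<mu>_S V by blast
  qed (use F(1) F_mono F_S \<mu>_S in auto)
  ultimately show ?thesis
    using that \<mu>_S by blast
qed

text \<open>
  If \<open>\<mu>\<close> is the unique law invariant under the single kernel \<open>P T\<close>, then it is invariant under the whole
  semigroup: transporting it by \<open>P t\<close> gives another law invariant under \<open>P T\<close>.
\<close>

lemma unique_invariant_law_of_skeleton:
  assumes P: "markov_semigroup S P" and T: "T \<ge> 0"
    and \<mu>: "set_pmf \<mu> \<subseteq> S" "bind_pmf \<mu> (P T) = \<mu>"
    and unique: "\<And>\<nu>. set_pmf \<nu> \<subseteq> S \<Longrightarrow> bind_pmf \<nu> (P T) = \<nu> \<Longrightarrow> \<nu> = \<mu>"
  shows "invariant_law S P \<nu> \<longleftrightarrow> \<nu> = \<mu>"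
proof -
  \<comment> \<open>Transporting \<open>\<mu>\<close> by \<open>P t\<close> commutes with transporting it by \<open>P T\<close>.\<close>
  have swap: "bind_pmf (bind_pmf \<mu> (P s)) (P t) = bind_pmf \<mu> (P (s + t))" if "s \<ge> 0" "t \<ge> 0" for s t
    unfolding bind_assoc_pmf
  proof (rule bind_pmf_cong[OF refl])
    fix x assume "x \<in> set_pmf \<mu>"
    then have "P (s + t) x = bind_pmf (P s x) (P t)"
      using P \<mu>(1) that unfolding markov_semigroup_def by blast
    then show "bind_pmf (P s x) (P t) = P (s + t) x" ..
  qed
  have "bind_pmf \<mu> (P t) = \<mu>" if t: "t \<ge> 0" for t
  proof (rule unique)
    have "set_pmf (P t x) \<subseteq> S" if "x \<in> set_pmf \<mu>" for x
      using P \<mu>(1) t that unfolding markov_semigroup_def by blast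
    then show "set_pmf (bind_pmf \<mu> (P t)) \<subseteq> S"
      by auto
    show "bind_pmf (bind_pmf \<mu> (P t)) (P T) = bind_pmf \<mu> (P t)"
      using swap[OF t T] swap[OF T t] \<mu>(2) by (simp add: add.commute)
  qed
  then show ?thesis
    using \<mu>(1) unique T unfolding invariant_law_def by blast
qed

section \<open>Subcritical offspring laws\<close>

text \<open>
  The moment generating function of the displacement \<open>l - 1\<close> equals \<open>1\<close> at \<open>\<theta> = 0\<close>, and its derivative
  there is the mean displacement, which is negative. Thus it lies below a line of negative slope on
  some interval \<open>{0..\<delta>}\<close>. The derivative is taken inside the disc of convergence of the generating
  function, which by the exponential moment contains \<open>1\<close> in its interior.
\<close>

lemma gw_subcritical_exponent:
  assumes "gw_offspring_law p"
  obtains \<delta> v :: real where "\<delta> > 0" "v > 0"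
    "\<forall>\<theta>\<in>{0..\<delta>}. \<exists>s \<le> - v * \<theta>. (\<lambda>l. pmf p l * (exp (\<theta> * (real l - 1)) - 1)) sums s"
proof -
  obtain \<sigma> where \<sigma>: "\<sigma> > 0" and mom: "summable (\<lambda>l. pmf p l * exp (\<sigma> * real l))"
    and sub: "(\<Sum>k. (real k - 1) * pmf p k) < 0"
    using assms unfolding gw_offspring_law_def by blast
  have conv: "summable (\<lambda>l. pmf p l * x ^ l)" if "\<bar>x\<bar> < exp \<sigma>" for x :: real
    by (rule powser_inside[of "pmf p" "exp \<sigma>"])
       (use mom that in \<open>auto simp: exp_of_nat2_mult[symmetric] mult.commute\<close>)
  define G where "G x = (\<Sum>l. pmf p l * x ^ l)" for x :: real
  define D where "D = (\<Sum>l. diffs (pmf p) l * 1 ^ l)"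
  have G_1: "G 1 = 1"
    using pmf_nat_sums_1[of p] by (simp add: G_def sums_iff)
  have G_deriv: "(G has_real_derivative D) (at 1)"
    unfolding G_def D_def
    by (rule termdiffs_strong'[of "exp \<sigma>"]) (use conv \<sigma> in auto)
  have "summable (\<lambda>l. diffs (pmf p) l * 1 ^ l)"
    by (rule termdiff_converges[of 1 "exp \<sigma>"]) (use conv \<sigma> in auto)
  then have "(\<lambda>l. real (Suc l) * pmf p (Suc l)) sums D"
    by (simp add: D_def summable_sums diffs_def)
  then have "(\<lambda>l. real l * pmf p l) sums D"
    by (subst (asm) sums_Suc_iff) simp
  from sums_diff[OF this pmf_nat_sums_1] have "(\<lambda>l. (real l - 1) * pmf p l) sums (D - 1)"
    by (simp add: algebra_simps)
  then have D: "D < 1"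
    using sub by (simp add: sums_iff)
  \<comment> \<open>\<open>H\<close> is the moment generating function of the displacement \<open>l - 1\<close>.\<close>
  define H where "H \<theta> = exp (- \<theta>) * G (exp \<theta>)" for \<theta> :: real
  have H_deriv: "(H has_real_derivative (D - 1)) (at 0)"
  proof -
    have "(G has_real_derivative D) (at (exp 0))"
      using G_deriv by simp
    from DERIV_chain2[where f = G and g = exp and x = 0, OF this DERIV_exp]
    have outer: "((\<lambda>\<theta>. G (exp \<theta>)) has_real_derivative D) (at 0)"
      by (simp only: exp_zero mult_1_right)
    have inner: "((\<lambda>\<theta>::real. exp (- \<theta>)) has_real_derivative - 1) (at 0)"
      by (auto intro!: derivative_eq_intros)
    have "D - 1 = - 1 * G (exp 0) + D * exp (- 0 :: real)"
      using G_1 by simp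
    then show ?thesis
      unfolding H_def using DERIV_mult[OF inner outer] by metis
  qed
  have H_sums: "(\<lambda>l. pmf p l * (exp (\<theta> * (real l - 1)) - 1)) sums (H \<theta> - 1)"
    if "0 \<le> \<theta>" "\<theta> < \<sigma>" for \<theta>
  proof -
    have "(\<lambda>l. pmf p l * exp \<theta> ^ l) sums G (exp \<theta>)"
      unfolding G_def by (rule summable_sums[OF conv]) (use that in simp)
    then have "(\<lambda>l. exp (- \<theta>) * (pmf p l * exp \<theta> ^ l) - pmf p l) sums (H \<theta> - 1)"
      unfolding H_def by (intro sums_diff sums_mult pmf_nat_sums_1)
    moreover have "exp (- \<theta>) * (pmf p l * exp \<theta> ^ l) - pmf p l = pmf p l * (exp (\<theta> * (real l - 1)) - 1)" for l
    proof -
      have "exp (\<theta> * (real l - 1)) = exp (- \<theta>) * exp \<theta> ^ l"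
        by (simp add: algebra_simps exp_of_nat_mult[symmetric] exp_add[symmetric])
      then show ?thesis
        by (simp add: algebra_simps)
    qed
    ultimately show ?thesis
      by simp
  qed
  have "((\<lambda>\<theta>. (H \<theta> - 1) / \<theta>) \<longlongrightarrow> D - 1) (at 0)"
    using H_deriv G_1 by (simp add: has_field_derivative_iff H_def)
  moreover have "D - 1 < (D - 1) / 2"
    using D by simp
  ultimately have "\<forall>\<^sub>F \<theta> in at 0. (H \<theta> - 1) / \<theta> < (D - 1) / 2"
    by (rule order_tendstoD(2))
  then obtain d where d: "d > 0" "\<And>\<theta>. \<theta> \<noteq> 0 \<Longrightarrow> \<bar>\<theta>\<bar> < d \<Longrightarrow> (H \<theta> - 1) / \<theta> < (D - 1) / 2"
    unfolding eventually_at by (auto simp: dist_real_def)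
  show ?thesis
  proof (rule that[of "min d \<sigma> / 2" "(1 - D) / 2"])
    show "\<forall>\<theta>\<in>{0..min d \<sigma> / 2}. \<exists>s \<le> - ((1 - D) / 2) * \<theta>.
        (\<lambda>l. pmf p l * (exp (\<theta> * (real l - 1)) - 1)) sums s"
    proof (intro ballI exI conjI)
      fix \<theta> assume "\<theta> \<in> {0..min d \<sigma> / 2}"
      then have \<theta>: "0 \<le> \<theta>" "\<theta> \<le> min d \<sigma> / 2"
        by auto
      have "\<theta> < d" "\<theta> < \<sigma>"
        using \<theta> d(1) \<sigma> by (auto simp: min_def split: if_splits)
      then show "(\<lambda>l. pmf p l * (exp (\<theta> * (real l - 1)) - 1)) sums (H \<theta> - 1)"
        using \<theta> by (intro H_sums)
      show "H \<theta> - 1 \<le> - ((1 - D) / 2) * \<theta>"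
      proof (cases "\<theta> = 0")
        case False
        then have "(H \<theta> - 1) / \<theta> < (D - 1) / 2"
          using \<theta> \<open>\<theta> < d\<close> by (intro d(2)) auto
        then show ?thesis
          using False \<theta> by (simp add: divide_simps algebra_simps split: if_splits)
      qed (simp add: H_def G_1)
    qed
  qed (use d(1) \<sigma> D in auto)
qed

text \<open>
  Without deaths every displacement would be nonnegative, contradicting the negative drift.
\<close>

lemma gw_offspring_law_pmf_0_pos:
  assumes "gw_offspring_law p"
  shows "pmf p 0 > 0"
proof (rule ccontr)
  assume "\<not> pmf p 0 > 0"
  then have p0: "pmf p 0 = 0"
    using pmf_nonneg[of p 0] by linarith
  obtain \<delta> v where "\<delta> > 0" "v > 0"
    and exponent: "\<forall>\<theta>\<in>{0..\<delta>}. \<exists>s \<le> - v * \<theta>.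
      (\<lambda>l. pmf p l * (exp (\<theta> * (real l - 1)) - 1)) sums s"
    by (rule gw_subcritical_exponent[OF assms])
  obtain s where s: "s \<le> - v * \<delta>"
    and sums: "(\<lambda>l. pmf p l * (exp (\<delta> * (real l - 1)) - 1)) sums s"
    using bspec[OF exponent, of \<delta>] \<open>\<delta> > 0\<close> by auto
  have "pmf p l * (exp (\<delta> * (real l - 1)) - 1) \<ge> 0" for l
    using p0 \<open>\<delta> > 0\<close> by (cases l) auto
  then have "s \<ge> 0"
    using sums_le[OF _ sums_zero sums] by blast
  moreover have "v * \<delta> > 0"
    using \<open>\<delta> > 0\<close> \<open>v > 0\<close> by simp
  ultimately show False
    using s by linarith
qed

section \<open>Configurations and the generator of the Fleming-Viot process\<close>

lemma configs_iff:
  "\<xi> \<in> configs N \<longleftrightarrow> \<xi> \<in> extensional {1..N} \<and> (\<forall>i\<in>{1..N}. 1 \<le> \<xi> i)"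
  unfolding configs_def PiE_iff by auto

lemma configs_fun_upd:
  assumes "\<xi> \<in> configs N" "i \<in> {1..N}" "1 \<le> y"
  shows "\<xi>(i := y) \<in> configs N"
  using assms unfolding configs_iff extensional_def by auto

lemma finite_bounded_configs: "finite {\<xi>\<in>configs N. \<forall>i\<in>{1..N}. real (\<xi> i) \<le> m}"
proof (rule finite_subset)
  show "{\<xi>\<in>configs N. \<forall>i\<in>{1..N}. real (\<xi> i) \<le> m} \<subseteq> {1..N} \<rightarrow>\<^sub>E {..nat \<lfloor>m\<rfloor>}"
    by (simp add: subset_eq PiE_iff configs_iff le_nat_floor)
  show "finite ({1..N} \<rightarrow>\<^sub>E {..nat \<lfloor>m\<rfloor>})"
    by (intro finite_PiE) auto
qed

lemma le_rightmost: "i \<in> {1..N} \<Longrightarrow> real (\<xi> i) \<le> rightmost N \<xi>"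
  by (simp add: rightmost_def)

lemma rightmost_attained:
  assumes "N \<ge> 1"
  obtains i where "i \<in> {1..N}" "rightmost N \<xi> = real (\<xi> i)"
proof -
  have "Max (\<xi> ` {1..N}) \<in> \<xi> ` {1..N}"
    using assms by (intro Max_in) auto
  then show ?thesis
    using that by (auto simp: rightmost_def)
qed

definition all_ones :: "nat \<Rightarrow> nat \<Rightarrow> nat" where
  "all_ones N = (\<lambda>i\<in>{1..N}. 1)"

lemma all_ones_in_configs: "all_ones N \<in> configs N"
  by (auto simp: all_ones_def configs_iff)

lemma rightmost_all_ones:
  assumes "N \<ge> 1"
  shows "rightmost N (all_ones N) = 1"
proof -
  have "all_ones N ` {1..N} = {1}"
    using assms by (force simp: all_ones_def)
  then show ?thesis
    by (simp add: rightmost_def)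
qed

lemma gw_rate_nonneg: "gw_rate p x y \<ge> 0"
  by (simp add: gw_rate_def)

text \<open>
  Summation over the target \<open>y\<close> is summation over the number \<open>l\<close> of offspring, where \<open>y = x + l - 1\<close>.
\<close>

lemma gw_rate_has_sum:
  fixes g :: "nat \<Rightarrow> real"
  assumes x: "1 \<le> x" and g: "((\<lambda>l. pmf p l * g (x + l - 1)) has_sum s) UNIV" and gx: "g x = 0"
  shows "((\<lambda>y. gw_rate p x y * g y) has_sum real x * s) UNIV"
proof -
  have "((\<lambda>l. real x * (pmf p l * g (x + l - 1))) has_sum real x * s) UNIV"
    using g by (rule has_sum_cmult_right)
  moreover have "real x * (pmf p l * g (x + l - 1)) = gw_rate p x (x + l - 1) * g (x + l - 1)" for l
  proof -
    consider "l = 0" | "l = 1" | "l \<ge> 2"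
      by linarith
    then show ?thesis
      using x gx by cases (auto simp: gw_rate_def)
  qed
  \<comment> \<open>The index \<open>l = 1\<close>, which is no jump, is harmless because \<open>g x = 0\<close>.\<close>
  ultimately have "((\<lambda>l. gw_rate p x (x + l - 1) * g (x + l - 1)) has_sum real x * s) UNIV"
    by (simp only:)
  then have "((\<lambda>y. gw_rate p x y * g y) has_sum real x * s) {x - 1..}"
  proof (subst (asm) has_sum_reindex_bij_witness[of UNIV "\<lambda>y. y + 1 - x" "\<lambda>l. x + l - 1" "{x - 1..}"
        "\<lambda>y. gw_rate p x y * g y"])
  qed (use x in auto)
  then show ?thesis
    by (subst has_sum_cong_neutral[of "{x - 1..}" UNIV _ "\<lambda>y. gw_rate p x y * g y"])
       (auto simp: gw_rate_def)
qed

definition fv_rate :: "nat pmf \<Rightarrow> nat \<Rightarrow> (nat \<Rightarrow> nat) \<Rightarrow> nat \<Rightarrow> nat \<Rightarrow> real" where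
  "fv_rate p N \<xi> i y =
     gw_rate p (\<xi> i) y + gw_rate p (\<xi> i) 0 * (real N / (real N - 1)) * empirical N y \<xi>"

lemma fv_generator_fv_rate:
  "fv_generator p N f \<xi> =
     (\<Sum>i=1..N. \<Sum>\<^sub>\<infinity>y\<in>{1..}. fv_rate p N \<xi> i y * (f (\<xi>(i := y)) - f \<xi>))"
  by (simp add: fv_generator_def fv_rate_def)

lemma fv_rate_nonneg:
  assumes "N \<ge> 2"
  shows "fv_rate p N \<xi> i y \<ge> 0"
  using assms unfolding fv_rate_def empirical_def
  by (intro add_nonneg_nonneg mult_nonneg_nonneg gw_rate_nonneg divide_nonneg_nonneg sum_nonneg) auto

lemma empirical_has_sum:
  assumes "\<xi> \<in> configs N"
  shows "((\<lambda>y. empirical N y \<xi> * g y) has_sum (\<Sum>j=1..N. g (\<xi> j)) / real N) {1..}"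
proof (rule has_sum_finite_neutralI)
  show "finite (\<xi> ` {1..N})"
    by simp
  show "\<xi> ` {1..N} \<subseteq> {1..}"
    using assms by (auto simp: configs_iff)
  show "empirical N y \<xi> * g y = 0" if "y \<in> {1..} - \<xi> ` {1..N}" for y
    using that by (auto simp: empirical_def)
  have "(\<Sum>y\<in>\<xi> ` {1..N}. empirical N y \<xi> * g y)
      = (\<Sum>y\<in>\<xi> ` {1..N}. \<Sum>j=1..N. of_bool (\<xi> j = y) * g y) / real N"
    by (simp add: empirical_def sum_distrib_right sum_divide_distrib)
  also have "\<dots> = (\<Sum>j=1..N. \<Sum>y\<in>\<xi> ` {1..N}. of_bool (\<xi> j = y) * g y) / real N"
    by (subst sum.swap) simp
  also have "\<dots> = (\<Sum>j=1..N. g (\<xi> j)) / real N"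
  proof -
    have "(\<Sum>y\<in>\<xi> ` {1..N}. of_bool (\<xi> j = y) * g y) = g (\<xi> j)" if "j \<in> {1..N}" for j
      using that by (simp add: of_bool_def if_distrib[of "\<lambda>c. c * _"] sum.delta cong: if_cong)
    then show ?thesis
      by simp
  qed
  finally show "(\<Sum>j=1..N. g (\<xi> j)) / real N = (\<Sum>y\<in>\<xi> ` {1..N}. empirical N y \<xi> * g y)" ..
qed

lemma fv_rate_has_sum:
  assumes N: "N \<ge> 2" and \<xi>: "\<xi> \<in> configs N" and i: "i \<in> {1..N}"
    and g: "((\<lambda>l. pmf p l * g (\<xi> i + l - 1)) has_sum s) UNIV" and gi: "g (\<xi> i) = 0"
  shows "((\<lambda>y. fv_rate p N \<xi> i y * g y) has_sum
    real (\<xi> i) * s + gw_rate p (\<xi> i) 0 * ((\<Sum>j=1..N. g (\<xi> j)) / (real N - 1) - g 0)) {1..}"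
proof -
  have "1 \<le> \<xi> i"
    using \<xi> i by (auto simp: configs_iff)
  then have "((\<lambda>y. gw_rate p (\<xi> i) y * g y) has_sum real (\<xi> i) * s) UNIV"
    using g gi by (rule gw_rate_has_sum)
  moreover have "((\<lambda>y. gw_rate p (\<xi> i) y * g y) has_sum gw_rate p (\<xi> i) 0 * g 0) {0}"
    using has_sum_finite[of "{0}" "\<lambda>y. gw_rate p (\<xi> i) y * g y"] by simp
  \<comment> \<open>Absorption at \<open>0\<close> is taken out of the Galton-Watson sum; relocation replaces it.\<close>
  ultimately have "((\<lambda>y. gw_rate p (\<xi> i) y * g y) has_sum
      real (\<xi> i) * s - gw_rate p (\<xi> i) 0 * g 0) (UNIV - {0})"
    by (rule has_sum_Diff) simp
  moreover have "UNIV - {0} = {1::nat..}"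
    by auto
  ultimately have "((\<lambda>y. gw_rate p (\<xi> i) y * g y +
        gw_rate p (\<xi> i) 0 * (real N / (real N - 1)) * (empirical N y \<xi> * g y)) has_sum
      real (\<xi> i) * s - gw_rate p (\<xi> i) 0 * g 0 +
        gw_rate p (\<xi> i) 0 * (real N / (real N - 1)) * ((\<Sum>j=1..N. g (\<xi> j)) / real N)) {1..}"
    by (intro has_sum_add has_sum_cmult_right empirical_has_sum[OF \<xi>]) simp
  moreover have "real (\<xi> i) * s - gw_rate p (\<xi> i) 0 * g 0 +
        gw_rate p (\<xi> i) 0 * (real N / (real N - 1)) * ((\<Sum>j=1..N. g (\<xi> j)) / real N)
      = real (\<xi> i) * s + gw_rate p (\<xi> i) 0 * ((\<Sum>j=1..N. g (\<xi> j)) / (real N - 1) - g 0)"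
    using N by (simp add: field_simps)
  moreover have "gw_rate p (\<xi> i) y * g y +
        gw_rate p (\<xi> i) 0 * (real N / (real N - 1)) * (empirical N y \<xi> * g y)
      = fv_rate p N \<xi> i y * g y" for y
    by (simp add: fv_rate_def algebra_simps)
  ultimately show ?thesis
    by (simp only:)
qed

lemma fv_rate_bounded_summable:
  fixes f :: "(nat \<Rightarrow> nat) \<Rightarrow> real"
  assumes N: "N \<ge> 2" and \<xi>: "\<xi> \<in> configs N" and i: "i \<in> {1..N}"
    and B: "bounded (f ` configs N)"
  shows "(\<lambda>y. fv_rate p N \<xi> i y * (f (\<xi>(i := y)) - f \<xi>)) summable_on {1..}"
proof -
  obtain C where C: "\<And>\<eta>. \<eta> \<in> configs N \<Longrightarrow> \<bar>f \<eta>\<bar> \<le> C"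
    using B by (auto simp: bounded_iff)
  \<comment> \<open>The increment vanishes at \<open>y = \<xi> i\<close>, so this indicator times \<open>2 * C\<close> dominates it.\<close>
  define g :: "nat \<Rightarrow> real" where "g y = of_bool (y \<noteq> \<xi> i)" for y
  have "summable (pmf p)"
    using pmf_nat_sums_1 by (rule sums_summable)
  then have "summable (\<lambda>l. norm (pmf p l * g (\<xi> i + l - 1)))"
    by (rule summable_comparison_test') (auto simp: g_def)
  then have "(\<lambda>l. pmf p l * g (\<xi> i + l - 1)) summable_on UNIV"
    by (rule norm_summable_imp_summable_on)
  then obtain s where "((\<lambda>l. pmf p l * g (\<xi> i + l - 1)) has_sum s) UNIV"
    unfolding summable_on_def by blast
  from fv_rate_has_sum[OF N \<xi> i this] have "(\<lambda>y. fv_rate p N \<xi> i y * g y) summable_on {1..}"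
    by (auto simp: g_def summable_on_def)
  then have "(\<lambda>y. 2 * C * (fv_rate p N \<xi> i y * g y)) summable_on {1..}"
    by (rule summable_on_cmult_right)
  then have "(\<lambda>y. norm (fv_rate p N \<xi> i y * (f (\<xi>(i := y)) - f \<xi>))) summable_on {1..}"
  proof (rule summable_on_comparison_test)
    fix y :: nat assume y: "y \<in> {1..}"
    have "\<bar>f (\<xi>(i := y)) - f \<xi>\<bar> \<le> 2 * C * g y"
      using C[OF configs_fun_upd[OF \<xi> i, of y]] C[OF \<xi>] y by (auto simp: g_def)
    from mult_left_mono[OF this fv_rate_nonneg[OF N, of p \<xi> i y]]
    show "norm (fv_rate p N \<xi> i y * (f (\<xi>(i := y)) - f \<xi>)) \<le> 2 * C * (fv_rate p N \<xi> i y * g y)"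
      using fv_rate_nonneg[OF N, of p \<xi> i y] by (simp add: abs_mult mult.left_commute mult.assoc)
  qed simp
  then show ?thesis
    by (rule abs_summable_summable)
qed

text \<open>
  The generator on a sum of exponentials. Branching contributes \<open>\<xi> j * exp (\<theta> * \<xi> j)\<close> times the exponent
  \<open>s\<close> of the offspring law. A particle is absorbed and relocated at rate at most \<open>1\<close>, and then gains on
  average at most the sum of all exponentials divided by \<open>N - 1\<close>. Over all \<open>N\<close> particles this is at most
  \<open>N / (N - 1) \<le> 2\<close> times the sum, a factor that does not depend on \<open>N\<close>.
\<close>

lemma fv_generator_exponential:
  fixes \<theta> c s :: real
  assumes N: "N \<ge> 2" and \<xi>: "\<xi> \<in> configs N" and \<theta>: "\<theta> \<ge> 0" and c: "c \<ge> 0"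
    and s: "(\<lambda>l. pmf p l * (exp (\<theta> * (real l - 1)) - 1)) sums s"
  defines "f \<equiv> \<lambda>\<eta>. c * (\<Sum>j=1..N. exp (\<theta> * real (\<eta> j)))"
  shows fv_generator_exponential_summable: "\<And>i. i \<in> {1..N} \<Longrightarrow>
      (\<lambda>y. fv_rate p N \<xi> i y * (f (\<xi>(i := y)) - f \<xi>)) summable_on {1..}"
    and fv_generator_exponential_le: "fv_generator p N f \<xi>
      \<le> c * (s * (\<Sum>j=1..N. real (\<xi> j) * exp (\<theta> * real (\<xi> j)))
          + 2 * (\<Sum>j=1..N. exp (\<theta> * real (\<xi> j))))"
proof -
  define E where "E j = exp (\<theta> * real (\<xi> j))" for j
  define F where "F = (\<Sum>j=1..N. E j)"
  define q where "q i = gw_rate p (\<xi> i) 0" for i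
  define r where "r i = c * (s * (real (\<xi> i) * E i)
      + q i * ((F - real N * E i) / (real N - 1) - (1 - E i)))" for i
  have s': "((\<lambda>l. pmf p l * (exp (\<theta> * (real l - 1)) - 1)) has_sum s) UNIV"
  proof (rule sums_nonneg_imp_has_sum_strong[OF s])
    show "\<forall>\<^sub>F l in sequentially. 0 \<le> pmf p l * (exp (\<theta> * (real l - 1)) - 1)"
      using \<theta> by (intro eventually_sequentiallyI[of 1]) auto
  qed
  have sum_i: "((\<lambda>y. fv_rate p N \<xi> i y * (f (\<xi>(i := y)) - f \<xi>)) has_sum r i) {1..}"
    if i: "i \<in> {1..N}" for i
  proof -
    define g where "g y = c * (exp (\<theta> * real y) - E i)" for y :: nat
    have f_g: "f (\<xi>(i := y)) - f \<xi> = g y" for y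
      using i by (simp add: f_def g_def E_def sum.remove[of _ i] algebra_simps)
    have "1 \<le> \<xi> i"
      using \<xi> i by (auto simp: configs_iff)
    have g_shift: "pmf p l * g (\<xi> i + l - 1) = c * E i * (pmf p l * (exp (\<theta> * (real l - 1)) - 1))" for l
    proof -
      have "exp (\<theta> * real (\<xi> i + l - 1)) = E i * exp (\<theta> * (real l - 1))"
        using \<open>1 \<le> \<xi> i\<close> by (simp add: E_def of_nat_diff exp_add[symmetric] algebra_simps)
      then show ?thesis
        by (simp add: g_def algebra_simps)
    qed
    have "((\<lambda>l. pmf p l * g (\<xi> i + l - 1)) has_sum c * E i * s) UNIV"
      unfolding g_shift by (rule has_sum_cmult_right[OF s'])
    from fv_rate_has_sum[OF N \<xi> i this]
    have "((\<lambda>y. fv_rate p N \<xi> i y * g y) has_sum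
        real (\<xi> i) * (c * E i * s) + q i * ((\<Sum>j=1..N. g (\<xi> j)) / (real N - 1) - g 0)) {1..}"
      by (simp add: g_def E_def q_def)
    moreover have "(\<Sum>j=1..N. g (\<xi> j)) = c * (F - real N * E i)"
      by (simp add: g_def F_def sum_distrib_left[symmetric] sum_subtractf E_def)
    moreover have "real (\<xi> i) * (c * E i * s) + q i * (c * (F - real N * E i) / (real N - 1) - g 0) = r i"
      unfolding r_def g_def by (simp add: algebra_simps)
    ultimately show ?thesis
      unfolding f_g by (simp only:)
  qed
  then show "\<And>i. i \<in> {1..N} \<Longrightarrow>
      (\<lambda>y. fv_rate p N \<xi> i y * (f (\<xi>(i := y)) - f \<xi>)) summable_on {1..}"
    by (auto simp: summable_on_def)
  \<comment> \<open>A relocated particle gives up its own exponential \<open>E i\<close>, which outweighs the \<open>E i\<close> that comes from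
    omitting absorption in the branching sum.\<close>
  have r_le: "r i \<le> c * (s * (real (\<xi> i) * E i) + F / (real N - 1))" if i: "i \<in> {1..N}" for i
  proof -
    have q: "0 \<le> q i" "q i \<le> 1"
      by (auto simp: q_def gw_rate_def pmf_le_1)
    have "E i \<le> real N * E i / (real N - 1)"
      using N by (simp add: E_def field_simps)
    then have "(F - real N * E i) / (real N - 1) - (1 - E i) \<le> F / (real N - 1)"
      by (simp add: diff_divide_distrib)
    then have "q i * ((F - real N * E i) / (real N - 1) - (1 - E i)) \<le> q i * (F / (real N - 1))"
      using q(1) by (rule mult_left_mono)
    also have "F / (real N - 1) \<ge> 0"
      using N by (auto simp: F_def E_def intro!: divide_nonneg_nonneg sum_nonneg)
    then have "q i * (F / (real N - 1)) \<le> F / (real N - 1)"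
      using q by (intro mult_left_le_one_le) auto
    finally show ?thesis
      unfolding r_def using c by (intro mult_left_mono) auto
  qed
  have "fv_generator p N f \<xi> = (\<Sum>i=1..N. r i)"
    unfolding fv_generator_fv_rate by (intro sum.cong refl infsumI sum_i)
  also have "\<dots> \<le> (\<Sum>i=1..N. c * (s * (real (\<xi> i) * E i) + F / (real N - 1)))"
    by (intro sum_mono r_le)
  also have "\<dots> = c * (s * (\<Sum>i=1..N. real (\<xi> i) * E i) + real N / (real N - 1) * F)"
    by (simp add: sum_distrib_left[symmetric] sum.distrib)
  also have "\<dots> \<le> c * (s * (\<Sum>i=1..N. real (\<xi> i) * E i) + 2 * F)"
  proof -
    have "real N / (real N - 1) \<le> 2"
      using N by (simp add: field_simps)
    moreover have "F \<ge> 0"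
      by (auto simp: F_def E_def intro!: sum_nonneg)
    ultimately show ?thesis
      using c by (intro mult_left_mono add_left_mono mult_right_mono)
  qed
  finally show "fv_generator p N f \<xi>
      \<le> c * (s * (\<Sum>j=1..N. real (\<xi> j) * exp (\<theta> * real (\<xi> j)))
          + 2 * (\<Sum>j=1..N. exp (\<theta> * real (\<xi> j))))"
    by (simp add: F_def E_def)
qed

text \<open>
  All rates are nonnegative, so the positive maximum principle holds term by term; convergence of both
  series is what allows the terms to be compared inside the sums.
\<close>

lemma fv_generator_mono_at_contact:
  assumes N: "N \<ge> 2" and \<xi>: "\<xi> \<in> configs N" and u: "bounded (u ` configs N)"
    and w: "\<And>i. i \<in> {1..N} \<Longrightarrow>
      (\<lambda>y. fv_rate p N \<xi> i y * (w (\<xi>(i := y)) - w \<xi>)) summable_on {1..}"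
    and le: "\<And>\<eta>. \<eta> \<in> configs N \<Longrightarrow> u \<eta> \<le> w \<eta> + c" and contact: "u \<xi> = w \<xi> + c"
  shows "fv_generator p N u \<xi> \<le> fv_generator p N w \<xi>"
  unfolding fv_generator_fv_rate
proof (intro sum_mono infsum_mono)
  fix i y assume i: "i \<in> {1..N}" and y: "y \<in> {1::nat..}"
  have "u (\<xi>(i := y)) - u \<xi> \<le> w (\<xi>(i := y)) - w \<xi>"
    using le[OF configs_fun_upd[OF \<xi> i]] y contact by force
  then show "fv_rate p N \<xi> i y * (u (\<xi>(i := y)) - u \<xi>)
      \<le> fv_rate p N \<xi> i y * (w (\<xi>(i := y)) - w \<xi>)"
    by (rule mult_left_mono[OF _ fv_rate_nonneg[OF N]])
qed (use w fv_rate_bounded_summable[OF N \<xi> _ u] in auto)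

lemma fv_generator_indicator_pos:
  assumes N: "N \<ge> 2" and \<xi>: "\<xi> \<in> configs N" and i: "i \<in> {1..N}" and ge: "\<xi> i \<ge> 2"
    and p0: "pmf p 0 > 0"
  shows "fv_generator p N (indicator {\<xi>(i := \<xi> i - 1)}) \<xi> > 0"
proof -
  define f :: "(nat \<Rightarrow> nat) \<Rightarrow> real" where "f = indicator {\<xi>(i := \<xi> i - 1)}"
  have f_\<xi>: "f \<xi> = 0"
  proof -
    have "(\<xi>(i := \<xi> i - 1)) i \<noteq> \<xi> i"
      using ge by simp
    then have "\<xi> \<noteq> \<xi>(i := \<xi> i - 1)"
      by metis
    then show ?thesis
      by (simp add: f_def)
  qed
  have f_bdd: "bounded (f ` configs N)"
    by (rule boundedI[where B = 1]) (auto simp: f_def indicator_def)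
  define t where "t j y = fv_rate p N \<xi> j y * (f (\<xi>(j := y)) - f \<xi>)" for j y
  have t_nonneg: "t j y \<ge> 0" for j y
    using fv_rate_nonneg[OF N] by (simp add: t_def f_\<xi>) (simp add: f_def)
  have t_summable: "t j summable_on {1..}" if "j \<in> {1..N}" for j
    unfolding t_def by (rule fv_rate_bounded_summable[OF N \<xi> that f_bdd])
  have "0 < real (\<xi> i) * pmf p 0"
    using ge p0 by simp
  also have "\<dots> = gw_rate p (\<xi> i) (\<xi> i - 1)"
    using ge by (simp add: gw_rate_def)
  also have "\<dots> \<le> fv_rate p N \<xi> i (\<xi> i - 1)"
    unfolding fv_rate_def empirical_def using N
    by (simp add: gw_rate_nonneg sum_nonneg)
  also have "\<dots> = t i (\<xi> i - 1)"
    unfolding t_def f_\<xi> by (simp add: f_def)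
  also have "\<dots> \<le> infsum (t i) {1..}"
    using finite_sum_le_infsum[OF t_summable[OF i], of "{\<xi> i - 1}"] ge t_nonneg by simp
  also have "\<dots> \<le> (\<Sum>j=1..N. infsum (t j) {1..})"
    using i t_nonneg by (intro member_le_sum infsum_nonneg) auto
  also have "\<dots> = fv_generator p N f \<xi>"
    by (simp add: fv_generator_fv_rate t_def[abs_def])
  finally show ?thesis
    by (simp add: f_def)
qed

text \<open>
  The particles beyond \<open>1\<close> can be lowered one unit at a time, each step having a positive rate because
  \<open>pmf p 0 > 0\<close>; the sum of the positions decreases.
\<close>

lemma fv_reaches_all_ones:
  assumes N: "N \<ge> 2" and P: "fleming_viot p N P" and p0: "pmf p 0 > 0"
    and "\<xi> \<in> configs N" and "t > 0"
  shows "pmf (P t \<xi>) (all_ones N) > 0"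
  using assms(4,5)
proof (induction "\<Sum>i=1..N. \<xi> i" arbitrary: \<xi> t rule: less_induct)
  case less
  have sg: "markov_semigroup (configs N) P" and gen: "has_generator (configs N) P (fv_generator p N)"
    using P by (auto simp: fleming_viot_def)
  show ?case
  proof (cases "\<exists>i\<in>{1..N}. \<xi> i \<ge> 2")
    case False
    have "\<xi> j = all_ones N j" for j
    proof (cases "j \<in> {1..N}")
      case True
      then have "\<xi> j \<ge> 1" "\<not> \<xi> j \<ge> 2"
        using less.prems(1) False by (auto simp: configs_iff)
      then show ?thesis
        using True by (simp add: all_ones_def)
    qed (use less.prems(1) in \<open>auto simp: configs_iff extensional_def all_ones_def\<close>)
    then have "\<xi> = all_ones N"
      by blast
    then show ?thesis
      using semigroup_stay_pos[OF sg gen less.prems(1)] less.prems(2) by simp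
  next
    case True
    then obtain i where i: "i \<in> {1..N}" "\<xi> i \<ge> 2"
      by blast
    define \<eta> where "\<eta> = \<xi>(i := \<xi> i - 1)"
    have \<eta>: "\<eta> \<in> configs N"
      unfolding \<eta>_def using i less.prems(1) by (intro configs_fun_upd) auto
    have "\<eta> i \<noteq> \<xi> i"
      using i by (simp add: \<eta>_def)
    then have "\<xi> \<noteq> \<eta>"
      by metis
    have "(\<Sum>j=1..N. \<eta> j) < (\<Sum>j=1..N. \<xi> j)"
      using i by (intro sum_strict_mono_ex1) (auto simp: \<eta>_def intro!: bexI[of _ i])
    then have "pmf (P (t / 2) \<eta>) (all_ones N) > 0"
      using less.hyps \<eta> less.prems(2) by simp
    moreover have "pmf (P (t / 2) \<xi>) \<eta> > 0"
      using semigroup_jump_pos[OF sg gen less.prems(1) \<eta> \<open>\<xi> \<noteq> \<eta>\<close>]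
        fv_generator_indicator_pos[OF N less.prems(1) i p0] less.prems(2)
      by (simp add: \<eta>_def)
    ultimately have "0 < pmf (P (t / 2) \<xi>) \<eta> * pmf (P (t / 2) \<eta>) (all_ones N)"
      by simp
    also have "\<dots> \<le> pmf (P (t / 2 + t / 2) \<xi>) (all_ones N)"
      using less.prems by (intro semigroup_pmf_add_ge[OF sg]) auto
    finally show ?thesis
      by simp
  qed
qed

section \<open>Drift of the rightmost particle\<close>

text \<open>
  With exponent \<open>\<phi> t = \<delta> * exp (- v * t)\<close>, the function \<open>w t \<eta> = exp (2 * t) * (\<Sum>j. exp (\<phi> t * \<eta> j))\<close> is a
  supersolution: decreasing the exponent at relative speed \<open>v\<close> changes each term by \<open>- v * \<phi> t * \<eta> j\<close> times
  itself, which is an upper bound for what branching does to it, and the prefactor pays for the relocations.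
  The comparison principle applies to the truncations of the exponential sum. The bound says that in mean the exponential sum with exponent \<open>\<delta>\<close>
  at time \<open>T\<close> is controlled by the one with the smaller exponent \<open>\<delta> * exp (- v * T)\<close> at time \<open>0\<close>.
\<close>

lemma fv_exponential_moment:
  fixes \<delta> v T :: real
  assumes N: "N \<ge> 2" and P: "fleming_viot p N P" and \<xi>: "\<xi> \<in> configs N" and T: "T \<ge> 0"
    and \<delta>: "\<delta> > 0" and v: "v > 0"
    and exponent: "\<forall>\<theta>\<in>{0..\<delta>}. \<exists>s \<le> - v * \<theta>.
       (\<lambda>l. pmf p l * (exp (\<theta> * (real l - 1)) - 1)) sums s"
  defines "Z \<equiv> \<lambda>\<eta>. \<Sum>i=1..N. exp (\<delta> * real (\<eta> i))"
  shows "integrable (measure_pmf (P T \<xi>)) Z \<and> measure_pmf.expectation (P T \<xi>) Z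
      \<le> exp (2 * T) * (\<Sum>i=1..N. exp (\<delta> * exp (- v * T) * real (\<xi> i)))"
proof -
  have sg: "markov_semigroup (configs N) P" and gen: "has_generator (configs N) P (fv_generator p N)"
    using P by (auto simp: fleming_viot_def)
  define \<phi> where "\<phi> t = \<delta> * exp (- v * t)" for t
  have \<phi>_pos: "\<phi> t > 0" for t
    using \<delta> by (simp add: \<phi>_def)
  have \<phi>_le: "\<phi> t \<le> \<delta>" if "t \<ge> 0" for t
    using \<delta> v that by (simp add: \<phi>_def)
  have \<phi>_mono: "\<phi> T \<le> \<phi> t" if "t \<le> T" for t
    using \<delta> v that by (simp add: \<phi>_def)
  have \<phi>_deriv: "(\<phi> has_real_derivative - v * \<phi> t) (at t)" for t
    unfolding \<phi>_def by (auto intro!: derivative_eq_intros)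
  define w where "w t \<eta> = exp (2 * t) * (\<Sum>j=1..N. exp (\<phi> t * real (\<eta> j)))" for t \<eta>
  define w' where "w' t \<eta> = exp (2 * t) * (- v * \<phi> t * (\<Sum>j=1..N. real (\<eta> j) * exp (\<phi> t * real (\<eta> j)))
      + 2 * (\<Sum>j=1..N. exp (\<phi> t * real (\<eta> j))))" for t \<eta>
  have w_exp: "w t = (\<lambda>\<eta>. exp (2 * t) * (\<Sum>j=1..N. exp (\<phi> t * real (\<eta> j))))" for t
    by (simp add: w_def fun_eq_iff)
  have w_summable: "(\<lambda>y. fv_rate p N \<eta> i y * (w t (\<eta>(i := y)) - w t \<eta>)) summable_on {1..}"
    if t: "0 \<le> t" and \<eta>: "\<eta> \<in> configs N" and i: "i \<in> {1..N}" for t \<eta> i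
  proof -
    obtain s where s: "(\<lambda>l. pmf p l * (exp (\<phi> t * (real l - 1)) - 1)) sums s"
      using bspec[OF exponent, of "\<phi> t"] \<phi>_pos[of t] \<phi>_le[OF t] by auto
    show ?thesis
      unfolding w_exp using \<phi>_pos[of t]
      by (intro fv_generator_exponential_summable[OF N \<eta> _ _ s i]) auto
  qed
  have trunc: "measure_pmf.expectation (P T \<xi>) (\<lambda>\<eta>. min (Z \<eta>) (real n)) \<le> w T \<xi>" for n :: nat
  proof (rule semigroup_comparison[OF sg gen, where B = "real n" and w' = w'])
    have Z_nonneg: "Z \<eta> \<ge> 0" for \<eta>
      by (auto simp: Z_def intro: sum_nonneg)
    show "\<forall>\<eta>\<in>configs N. \<bar>min (Z \<eta>) (real n)\<bar> \<le> real n"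
      using Z_nonneg by (auto simp: min_def)
    show "min (Z \<eta>) (real n) \<le> w 0 \<eta>" for \<eta>
      by (simp add: w_def Z_def \<phi>_def)
    show "((\<lambda>s. w s \<eta>) has_real_derivative w' t \<eta>) (at t)" for t \<eta>
    proof -
      have "((\<lambda>s. exp (\<phi> s * real (\<eta> j))) has_real_derivative
          - v * \<phi> t * (real (\<eta> j) * exp (\<phi> t * real (\<eta> j)))) (at t)" for j
        by (auto intro!: derivative_eq_intros \<phi>_deriv)
      then have D1: "((\<lambda>s. \<Sum>j=1..N. exp (\<phi> s * real (\<eta> j))) has_real_derivative
          (\<Sum>j=1..N. - v * \<phi> t * (real (\<eta> j) * exp (\<phi> t * real (\<eta> j))))) (at t)"
        by (rule DERIV_sum)
      have D2: "((\<lambda>s::real. exp (2 * s)) has_real_derivative 2 * exp (2 * t)) (at t)"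
        by (auto intro!: derivative_eq_intros)
      show ?thesis
        unfolding w_def w'_def
        by (rule DERIV_cong[OF DERIV_mult[OF D2 D1]]) (simp add: sum_distrib_left algebra_simps)
    qed
    show "fv_generator p N (w t) \<eta> \<le> w' t \<eta>" if t: "0 \<le> t" "t \<le> T" and \<eta>: "\<eta> \<in> configs N" for t \<eta>
    proof -
      obtain s where s: "(\<lambda>l. pmf p l * (exp (\<phi> t * (real l - 1)) - 1)) sums s" "s \<le> - v * \<phi> t"
        using bspec[OF exponent, of "\<phi> t"] \<phi>_pos[of t] \<phi>_le[OF t(1)] by auto
      have "fv_generator p N (w t) \<eta> \<le> exp (2 * t) *
          (s * (\<Sum>j=1..N. real (\<eta> j) * exp (\<phi> t * real (\<eta> j))) + 2 * (\<Sum>j=1..N. exp (\<phi> t * real (\<eta> j))))"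
        unfolding w_exp using \<phi>_pos[of t]
        by (intro fv_generator_exponential_le[OF N \<eta> _ _ s(1)]) auto
      also have "\<dots> \<le> w' t \<eta>"
        unfolding w'_def using s(2)
        by (intro mult_left_mono add_right_mono mult_right_mono sum_nonneg) auto
      finally show ?thesis .
    qed
    show "fv_generator p N u \<eta> \<le> fv_generator p N (w t) \<eta>"
      if "0 \<le> t" "t \<le> T" "\<eta> \<in> configs N" "bounded (u ` configs N)"
        "\<And>z. z \<in> configs N \<Longrightarrow> u z \<le> w t z + c" "u \<eta> = w t \<eta> + c" for t u c \<eta>
      using that w_summable by (intro fv_generator_mono_at_contact[OF N that(3,4), where c = c]) auto
    show "finite {\<eta>\<in>configs N. \<exists>t\<in>{0..T}. w t \<eta> \<le> m}" for m
    proof (rule finite_subset[OF _ finite_bounded_configs[of N "m / \<phi> T"]], safe)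
      fix \<eta> t i assume \<eta>: "\<eta> \<in> configs N" and t: "t \<in> {0..T}" and le: "w t \<eta> \<le> m" and i: "i \<in> {1..N}"
      have "\<phi> T * real (\<eta> i) \<le> \<phi> t * real (\<eta> i)"
        using \<phi>_mono t by (intro mult_right_mono) auto
      also have "\<dots> \<le> exp (\<phi> t * real (\<eta> i))"
        using exp_ge_add_one_self[of "\<phi> t * real (\<eta> i)"] by linarith
      also have "\<dots> \<le> (\<Sum>j=1..N. exp (\<phi> t * real (\<eta> j)))"
        using i by (intro member_le_sum) auto
      also have "\<dots> \<le> w t \<eta>"
      proof -
        have "1 * (\<Sum>j=1..N. exp (\<phi> t * real (\<eta> j)))
            \<le> exp (2 * t) * (\<Sum>j=1..N. exp (\<phi> t * real (\<eta> j)))"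
          using t by (intro mult_right_mono sum_nonneg) auto
        then show ?thesis
          by (simp add: w_def)
      qed
      finally show "real (\<eta> i) \<le> m / \<phi> T"
        using le \<phi>_pos[of T] by (simp add: field_simps)
    qed
  qed (use T \<xi> in auto)
  have "Z \<eta> \<ge> 0" for \<eta>
    by (auto simp: Z_def intro: sum_nonneg)
  from pmf_moment_le_if_truncated[OF this trunc] show ?thesis
    by (simp add: w_def \<phi>_def)
qed

text \<open>
  Either the rightmost particle has fallen below half of its initial position \<open>R\<close>, or some particle is
  beyond \<open>R / 2\<close>. To the latter each particle contributes an amount that is exponentially small in \<open>R\<close>: all
  initial positions are at most \<open>R\<close>, so the exponential moment bound limits the sum of the contributions to
  \<open>N * exp (2 * T) * exp (3 / 4 * \<rho> * R - \<rho> * R)\<close>.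
\<close>

lemma fv_rightmost_drift:
  fixes \<delta> v \<rho> T :: real
  assumes N: "N \<ge> 2" and P: "fleming_viot p N P" and \<xi>: "\<xi> \<in> configs N"
    and \<rho>: "\<rho> > 0" and v: "v > 0" and T: "exp (- v * T) = 1 / 4" "T \<ge> 0"
    and exponent: "\<forall>\<theta>\<in>{0..3 * \<rho>}. \<exists>s \<le> - v * \<theta>.
       (\<lambda>l. pmf p l * (exp (\<theta> * (real l - 1)) - 1)) sums s"
  defines "R \<equiv> rightmost N \<xi>"
  shows "integrable (measure_pmf (P T \<xi>)) (\<lambda>\<eta>. exp (\<rho> * rightmost N \<eta>)) \<and>
    measure_pmf.expectation (P T \<xi>) (\<lambda>\<eta>. exp (\<rho> * rightmost N \<eta>))
      \<le> exp (\<rho> * R / 2) + real N * exp (2 * T) * exp (- (\<rho> / 4) * R)"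
proof -
  define Z where "Z \<eta> = (\<Sum>i=1..N. exp (3 * \<rho> * real (\<eta> i)))" for \<eta> :: "nat \<Rightarrow> nat"
  have Z: "integrable (measure_pmf (P T \<xi>)) Z"
    "measure_pmf.expectation (P T \<xi>) Z
      \<le> exp (2 * T) * (\<Sum>i=1..N. exp (3 * \<rho> * (1 / 4) * real (\<xi> i)))"
    using fv_exponential_moment[OF N P \<xi> T(2) _ v exponent] \<rho> unfolding T(1) Z_def[abs_def]
    by auto
  \<comment> \<open>If some particle is beyond \<open>R / 2\<close>, the excess \<open>exp (2 * \<rho> * (\<eta> i - R / 2)) \<ge> 1\<close> may be
    inserted as a factor, which raises the exponent from \<open>\<rho>\<close> to \<open>3 * \<rho>\<close>.\<close>
  have pointwise: "exp (\<rho> * rightmost N \<eta>) \<le> exp (\<rho> * R / 2) + exp (- \<rho> * R) * Z \<eta>" for \<eta>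
  proof -
    have Z_nonneg: "Z \<eta> \<ge> 0"
      by (auto simp: Z_def intro: sum_nonneg)
    show ?thesis
    proof (cases "rightmost N \<eta> \<le> R / 2")
      case True
      then have "exp (\<rho> * rightmost N \<eta>) \<le> exp (\<rho> * R / 2)"
        using \<rho> by (simp add: field_simps)
      then show ?thesis
        using Z_nonneg by (simp add: add_increasing2)
    next
      case False
      obtain i where i: "i \<in> {1..N}" "rightmost N \<eta> = real (\<eta> i)"
        using rightmost_attained[of N \<eta>] N by auto
      have "\<rho> * (2 * real (\<eta> i) - R) \<ge> 0"
        using \<rho> False i(2) by (intro mult_nonneg_nonneg) auto
      then have "exp (\<rho> * rightmost N \<eta>) \<le> exp (- \<rho> * R + 3 * \<rho> * real (\<eta> i))"
        unfolding i(2) by (simp add: algebra_simps)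
      also have "\<dots> = exp (- \<rho> * R) * exp (3 * \<rho> * real (\<eta> i))"
        by (rule exp_add)
      also have "\<dots> \<le> exp (- \<rho> * R) * Z \<eta>"
        unfolding Z_def using i(1) by (intro mult_left_mono member_le_sum) auto
      finally show ?thesis
        by (simp add: add_increasing)
    qed
  qed
  have int: "integrable (measure_pmf (P T \<xi>)) (\<lambda>\<eta>. exp (\<rho> * R / 2) + exp (- \<rho> * R) * Z \<eta>)"
    using Z(1) by simp
  have intR: "integrable (measure_pmf (P T \<xi>)) (\<lambda>\<eta>. exp (\<rho> * rightmost N \<eta>))"
    by (rule Bochner_Integration.integrable_bound[OF int])
      (use pointwise in \<open>auto intro!: order.trans[OF pointwise] simp: abs_of_nonneg\<close>)
  have "measure_pmf.expectation (P T \<xi>) (\<lambda>\<eta>. exp (\<rho> * rightmost N \<eta>))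
      \<le> measure_pmf.expectation (P T \<xi>) (\<lambda>\<eta>. exp (\<rho> * R / 2) + exp (- \<rho> * R) * Z \<eta>)"
    by (rule integral_mono[OF intR int pointwise])
  also have "\<dots> = exp (\<rho> * R / 2) + exp (- \<rho> * R) * measure_pmf.expectation (P T \<xi>) Z"
    using Z(1) by simp
  also have "\<dots> \<le> exp (\<rho> * R / 2) + exp (- \<rho> * R) *
      (exp (2 * T) * (real N * exp (3 * \<rho> * (1 / 4) * R)))"
  proof -
    have "(\<Sum>i=1..N. exp (3 * \<rho> * (1 / 4) * real (\<xi> i))) \<le> (\<Sum>i=1..N. exp (3 * \<rho> * (1 / 4) * R))"
      using \<rho> le_rightmost[of _ N \<xi>] by (intro sum_mono) (simp add: R_def)
    then have "measure_pmf.expectation (P T \<xi>) Z \<le> exp (2 * T) * (real N * exp (3 * \<rho> * (1 / 4) * R))"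
      using Z(2) by (elim order.trans) simp
    then show ?thesis
      by (intro add_left_mono mult_left_mono) auto
  qed
  also have "\<dots> = exp (\<rho> * R / 2) + real N * exp (2 * T) * (exp (- \<rho> * R) * exp (3 * \<rho> * (1 / 4) * R))"
    by (simp add: algebra_simps)
  also have "exp (- \<rho> * R) * exp (3 * \<rho> * (1 / 4) * R) = exp (- (\<rho> / 4) * R)"
    unfolding exp_add[symmetric] by (simp add: algebra_simps)
  finally show ?thesis
    using intR by simp
qed

section \<open>Drift, invariant law and its exponential moment\<close>

theorem proposition1p2:
  fixes p :: "nat pmf"
  assumes "gw_offspring_law p"
  shows "\<exists>T A c1 c2 C \<rho> :: real.
    T > 0 \<and> A > 0 \<and> c1 > 0 \<and> c2 > 0 \<and> C > 0 \<and> \<rho> > 0 \<and>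
    (\<forall>N P. N \<ge> 2 \<longrightarrow> fleming_viot p N P \<longrightarrow>
      (\<forall>\<xi>\<in>configs N.
        integrable (measure_pmf (P T \<xi>)) (\<lambda>\<eta>. exp (\<rho> * rightmost N \<eta>)) \<and>
        measure_pmf.expectation (P T \<xi>) (\<lambda>\<eta>. exp (\<rho> * rightmost N \<eta>))
            - exp (\<rho> * rightmost N \<xi>)
          < - c1 * exp (\<rho> * rightmost N \<xi>) * of_bool (rightmost N \<xi> > A)
            + real N * c2 * exp (- C * rightmost N \<xi>))) \<and>
    (\<forall>N P. N \<ge> 2 \<longrightarrow> fleming_viot p N P \<longrightarrow>
      (\<exists>!\<mu>. invariant_law (configs N) P \<mu>)) \<and>
    (\<exists>\<kappa>>0. \<forall>N P. N \<ge> 2 \<longrightarrow> fleming_viot p N P \<longrightarrow>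
      (\<forall>\<mu>. invariant_law (configs N) P \<mu> \<longrightarrow>
        integrable (measure_pmf \<mu>) (\<lambda>\<xi>. exp (\<rho> * rightmost N \<xi>)) \<and>
        measure_pmf.expectation \<mu> (\<lambda>\<xi>. exp (\<rho> * rightmost N \<xi>)) \<le> \<kappa> * real N))"
proof -
  obtain \<delta> v where \<delta>: "\<delta> > 0" and v: "v > 0"
    and exponent: "\<forall>\<theta>\<in>{0..\<delta>}. \<exists>s \<le> - v * \<theta>.
       (\<lambda>l. pmf p l * (exp (\<theta> * (real l - 1)) - 1)) sums s"
    by (rule gw_subcritical_exponent[OF assms])
  \<comment> \<open>\<open>\<rho>\<close> leaves room for the exponent \<open>3 * \<rho>\<close>; \<open>T\<close> makes the exponent shrink by the factor \<open>4\<close>,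
    so that \<open>3 * \<rho> / 4 < \<rho>\<close> leaves the exponential decay at rate \<open>\<rho> / 4\<close>.\<close>
  define \<rho> where "\<rho> = \<delta> / 3"
  define T where "T = ln 4 / v"
  define \<gamma> where "\<gamma> = exp (- (\<rho> / 2))"
  define c1 where "c1 = 1 - \<gamma>"
  define c2 where "c2 = exp (2 * T) + 1"
  define \<kappa> where "\<kappa> = exp \<rho> + c2 / c1"
  define V where "V N \<xi> = exp (\<rho> * rightmost N \<xi>)" for N \<xi>
  have \<rho>: "\<rho> > 0"
    using \<delta> by (simp add: \<rho>_def)
  have T: "T > 0" "exp (- v * T) = 1 / 4"
    using v by (auto simp: T_def exp_minus divide_simps)
  have c: "c1 > 0" "c2 > 0"
    using \<rho> by (auto simp: c1_def c2_def \<gamma>_def add_pos_pos)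
  \<comment> \<open>Positions are at least \<open>1\<close>, so the contraction holds everywhere and \<open>A = 1 / 2\<close> serves below.\<close>
  have R_ge_1: "rightmost N \<xi> \<ge> 1" if "N \<ge> 2" "\<xi> \<in> configs N" for N \<xi>
    using le_rightmost[of 1 N \<xi>] that by (force simp: configs_iff)
  have drift: "integrable (measure_pmf (P T \<xi>)) (V N) \<and> measure_pmf.expectation (P T \<xi>) (V N)
      < \<gamma> * V N \<xi> + real N * c2 * exp (- (\<rho> / 4) * rightmost N \<xi>)"
    if N: "N \<ge> 2" and P: "fleming_viot p N P" and \<xi>: "\<xi> \<in> configs N" for N P \<xi>
  proof -
    let ?R = "rightmost N \<xi>"
    have "integrable (measure_pmf (P T \<xi>)) (V N)"
      and le: "measure_pmf.expectation (P T \<xi>) (V N)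
        \<le> exp (\<rho> * ?R / 2) + real N * exp (2 * T) * exp (- (\<rho> / 4) * ?R)"
      using fv_rightmost_drift[OF N P \<xi> \<rho> v T(2)] exponent T(1)
      by (auto simp: V_def[abs_def] \<rho>_def)
    moreover have "exp (\<rho> * ?R / 2) \<le> \<gamma> * V N \<xi>"
    proof -
      have "\<rho> * ?R / 2 \<le> - (\<rho> / 2) + \<rho> * ?R"
        using R_ge_1[OF N \<xi>] \<rho> by (simp add: field_simps)
      then show ?thesis
        unfolding \<gamma>_def V_def exp_add[symmetric] by simp
    qed
    moreover have "real N * exp (2 * T) * exp (- (\<rho> / 4) * ?R) < real N * c2 * exp (- (\<rho> / 4) * ?R)"
      using N by (simp add: c2_def)
    ultimately show ?thesis
      by linarith
  qed
  have stationary: "\<exists>\<mu>. (\<forall>\<nu>. invariant_law (configs N) P \<nu> \<longleftrightarrow> \<nu> = \<mu>) \<and>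
      integrable (measure_pmf \<mu>) (V N) \<and> measure_pmf.expectation \<mu> (V N) \<le> \<kappa> * real N"
    if N: "N \<ge> 2" and P: "fleming_viot p N P" for N P
  proof -
    have sg: "markov_semigroup (configs N) P"
      using P by (simp add: fleming_viot_def)
    \<comment> \<open>\<open>real N * c2 / c1\<close> is the fixed point of \<open>B \<mapsto> \<gamma> * B + real N * c2\<close>; the term \<open>exp \<rho>\<close> covers
      the starting point.\<close>
    define B where "B = exp \<rho> + real N * c2 / c1"
    obtain \<mu> where \<mu>: "set_pmf \<mu> \<subseteq> configs N" "bind_pmf \<mu> (P T) = \<mu>"
      "integrable (measure_pmf \<mu>) (V N)" "measure_pmf.expectation \<mu> (V N) \<le> B"
    proof (rule stationary_pmf_exists[where K = "P T" and S = "configs N" and V = "V N"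
          and a = "all_ones N" and \<gamma> = \<gamma> and b = "real N * c2" and B = B])
      show "set_pmf (P T \<xi>) \<subseteq> configs N" if "\<xi> \<in> configs N" for \<xi>
        using sg T(1) that unfolding markov_semigroup_def by (meson less_imp_le)
      show "all_ones N \<in> configs N"
        by (rule all_ones_in_configs)
      show "V N \<xi> \<ge> 0" for \<xi>
        by (simp add: V_def)
      show "finite {\<xi>\<in>configs N. V N \<xi> \<le> m}" for m
      proof (rule finite_subset[OF _ finite_bounded_configs[of N "m / \<rho>"]], safe)
        fix \<xi> i assume \<xi>: "\<xi> \<in> configs N" "V N \<xi> \<le> m" and i: "i \<in> {1..N}"
        have "\<rho> * real (\<xi> i) \<le> \<rho> * rightmost N \<xi>"
          using \<rho> le_rightmost[OF i] by simp
        also have "\<dots> \<le> V N \<xi>"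
          unfolding V_def using exp_ge_add_one_self[of "\<rho> * rightmost N \<xi>"] by linarith
        finally show "real (\<xi> i) \<le> m / \<rho>"
          using \<rho> \<xi>(2) by (simp add: field_simps)
      qed
      show "integrable (measure_pmf (P T \<xi>)) (V N) \<and>
          measure_pmf.expectation (P T \<xi>) (V N) \<le> \<gamma> * V N \<xi> + real N * c2"
        if \<xi>: "\<xi> \<in> configs N" for \<xi>
      proof -
        have "exp (- (\<rho> / 4) * rightmost N \<xi>) \<le> 1"
          using \<rho> R_ge_1[OF N \<xi>] by simp
        then have "real N * c2 * exp (- (\<rho> / 4) * rightmost N \<xi>) \<le> real N * c2"
          using c by (intro mult_right_le_one_le) auto
        then show ?thesis
          using drift[OF N P \<xi>] by linarith
      qed
      show "\<gamma> \<ge> 0"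
        by (simp add: \<gamma>_def)
      show "V N (all_ones N) \<le> B"
        using c N by (simp add: V_def B_def rightmost_all_ones)
      have "\<gamma> * B + real N * c2 = B - c1 * exp \<rho>"
        using c by (simp add: B_def c1_def field_simps)
      then show "\<gamma> * B + real N * c2 \<le> B"
        using c by simp
    qed
    have "\<nu> = \<mu>" if "set_pmf \<nu> \<subseteq> configs N" "bind_pmf \<nu> (P T) = \<nu>" for \<nu>
    proof (rule stationary_pmf_unique)
      show "pmf (P T \<xi>) (all_ones N) > 0" if "\<xi> \<in> configs N" for \<xi>
        using fv_reaches_all_ones[OF N P gw_offspring_law_pmf_0_pos[OF assms] that T(1)] .
    qed (fact that \<mu>(1,2))+
    then have "\<forall>\<nu>. invariant_law (configs N) P \<nu> \<longleftrightarrow> \<nu> = \<mu>"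
      using unique_invariant_law_of_skeleton[OF sg _ \<mu>(1,2)] T(1) by auto
    moreover have "B \<le> \<kappa> * real N"
      using N by (simp add: B_def \<kappa>_def algebra_simps)
    ultimately show ?thesis
      using \<mu>(3,4) by (intro exI[of _ \<mu>]) auto
  qed
  show ?thesis
  proof (rule exI[of _ T], rule exI[of _ "1 / 2"], rule exI[of _ c1], rule exI[of _ c2],
      rule exI[of _ "\<rho> / 4"], rule exI[of _ \<rho>], intro conjI allI impI ballI)
    fix N P \<xi> assume N: "N \<ge> (2 :: nat)" and P: "fleming_viot p N P" and \<xi>: "\<xi> \<in> configs N"
    note d = drift[OF N P \<xi>]
    show "integrable (measure_pmf (P T \<xi>)) (\<lambda>\<eta>. exp (\<rho> * rightmost N \<eta>))"
      using d by (simp add: V_def[abs_def])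
    show "measure_pmf.expectation (P T \<xi>) (\<lambda>\<eta>. exp (\<rho> * rightmost N \<eta>)) - exp (\<rho> * rightmost N \<xi>)
        < - c1 * exp (\<rho> * rightmost N \<xi>) * of_bool (rightmost N \<xi> > 1 / 2)
          + real N * c2 * exp (- (\<rho> / 4) * rightmost N \<xi>)"
      using d R_ge_1[OF N \<xi>] by (simp add: V_def[abs_def] c1_def algebra_simps)
  next
    fix N P assume "N \<ge> (2 :: nat)" "fleming_viot p N P"
    then show "\<exists>!\<mu>. invariant_law (configs N) P \<mu>"
      using stationary by (metis (no_types, lifting))
  next
    have "\<kappa> > 0"
      using c by (simp add: \<kappa>_def add_pos_pos)
    moreover have "integrable (measure_pmf \<mu>) (\<lambda>\<xi>. exp (\<rho> * rightmost N \<xi>)) \<and>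
        measure_pmf.expectation \<mu> (\<lambda>\<xi>. exp (\<rho> * rightmost N \<xi>)) \<le> \<kappa> * real N"
      if "N \<ge> 2" "fleming_viot p N P" "invariant_law (configs N) P \<mu>" for N P \<mu>
      using stationary[OF that(1,2)] that(3) by (auto simp: V_def[abs_def])
    ultimately show "\<exists>\<kappa>>0. \<forall>N P. N \<ge> 2 \<longrightarrow> fleming_viot p N P \<longrightarrow>
      (\<forall>\<mu>. invariant_law (configs N) P \<mu> \<longrightarrow>
        integrable (measure_pmf \<mu>) (\<lambda>\<xi>. exp (\<rho> * rightmost N \<xi>)) \<and>
        measure_pmf.expectation \<mu> (\<lambda>\<xi>. exp (\<rho> * rightmost N \<xi>)) \<le> \<kappa> * real N)"
      by blast
  qed (use T \<rho> c in auto)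
qed

end
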